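(* Let $n\ge 1$ and let $S\subseteq\mathcal{L}(\mathbb{C}^2)$ and $T\subseteq\mathcal{L}(\mathbb{C}^n)$ be noncommutative graphs. If the (asymptotic) zero-error classical capacity of $S$ and $T$ can be activated, i.e. if at least one of $\mathcal{C}_0(S)$, $\mathcal{C}_0(T)$ equals $0$ and $$\mathcal{C}_0(S\otimes T)>\mathcal{C}_0(S)+\mathcal{C}_0(T),$$ then $S=\mathbb{C}I_2$.
   Context: $\mathcal{L}(\mathbb{C}^n)$ is the space of linear operators ($n\times n$ complex matrices) on $\mathbb{C}^n$, with Hilbert–Schmidt inner product $\langle X,Y\rangle=\mathrm{Tr}(X^\dagger Y)$; $\perp$ refers to this inner product. A noncommutative graph is a complex linear subspace $S\subseteq\mathcal{L}(\mathbb{C}^n)$ with $S=S^\dagger$ (closed under conjugate transpose) and $I\in S$. For a noncommutative graph $S\subseteq\mathcal{L}(\mathbb{C}^n)$, let $\alpha(S)$ be the maximum number $m$ of nonzero vectors $|\psi_1\rangle,\dots,|\psi_m\rangle\in\mathbb{C}^n$ such that $|\psi_s\rangle\langle\psi_t|\perp S$ for all $s\ne t$. The one-shot zero-error classical capacity is $\mathcal{C}_0^{(1)}(S)=\log_2\alpha(S)$, and the (asymptotic) zero-error classical capacity is $\mathcal{C}_0(S)=\lim_{k\to\infty}\frac1k\mathcal{C}_0^{(1)}(S^{\otimes k})$. $S\otimes T$ denotes the span of all $P\otimes Q$ with $P\in S$, $Q\in T$; it is again a noncommutative graph. $I_2$ is the $2\times2$ identity matrix. *)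

theory Defs
  imports
    Complex_Main
    "Jordan_Normal_Form.VS_Connect"
    "Jordan_Normal_Form.Schur_Decomposition"
begin

abbreviation operators :: "nat \<Rightarrow> (complex, complex mat) module" where
  "operators n \<equiv> module_mat TYPE(complex) n n"

definition mat_trace :: "complex mat \<Rightarrow> complex" where
  "mat_trace A = (\<Sum>i<dim_row A. A $$ (i, i))"

definition hs_inner :: "complex mat \<Rightarrow> complex mat \<Rightarrow> complex" where
  "hs_inner X Y = mat_trace (mat_adjoint X * Y)"

definition hs_orthogonal :: "complex mat \<Rightarrow> complex mat set \<Rightarrow> bool" where
  "hs_orthogonal X S \<longleftrightarrow> (\<forall>Y\<in>S. hs_inner X Y = 0)"

definition ket_bra :: "complex vec \<Rightarrow> complex vec \<Rightarrow> complex mat" where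
  "ket_bra v w = mat (dim_vec v) (dim_vec w) (\<lambda>(i, j). v $ i * cnj (w $ j))"

definition nc_graph :: "nat \<Rightarrow> complex mat set \<Rightarrow> bool" where
  "nc_graph n S \<longleftrightarrow>
     VectorSpace.subspace class_ring S (operators n) \<and> mat_adjoint ` S = S \<and> 1\<^sub>m n \<in> S"

text \<open>The Kronecker product identifies \<open>\<complex>\<^sup>n \<otimes> \<complex>\<^sup>m\<close> with \<open>\<complex>\<^sup>n\<^sup>m\<close> by sending
  the basis vector \<open>e\<^sub>a \<otimes> e\<^sub>b\<close> to \<open>e\<^sub>i\<close> where \<open>i = a m + b\<close> (indices start at 0).\<close>
definition kronecker :: "complex mat \<Rightarrow> complex mat \<Rightarrow> complex mat" where
  "kronecker A B =
     mat (dim_row A * dim_row B) (dim_col A * dim_col B)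
       (\<lambda>(i, j). A $$ (i div dim_row B, j div dim_col B) * B $$ (i mod dim_row B, j mod dim_col B))"

definition nc_tensor ::
    "nat \<Rightarrow> complex mat set \<Rightarrow> nat \<Rightarrow> complex mat set \<Rightarrow> complex mat set" where
  "nc_tensor n S m T =
     LinearCombinations.module.span class_ring (operators (n * m))
       {kronecker P Q | P Q. P \<in> S \<and> Q \<in> T}"

text \<open>\<open>nc_power n S k\<close> acts on a space of dimension \<open>n ^ k\<close>; the empty tensor power is the
  full (one-dimensional) operator space of \<open>\<complex>\<close>.\<close>
fun nc_power :: "nat \<Rightarrow> complex mat set \<Rightarrow> nat \<Rightarrow> complex mat set" where
  "nc_power n S 0 = carrier_mat 1 1"
| "nc_power n S (Suc k) = nc_tensor (n ^ k) (nc_power n S k) n S"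

text \<open>Since \<open>I \<in> S\<close>, admissible families are orthogonal, so the set below is bounded by \<open>n\<close>.\<close>
definition independence_number :: "nat \<Rightarrow> complex mat set \<Rightarrow> nat" where
  "independence_number n S =
     Max {m. \<exists>\<psi> :: nat \<Rightarrow> complex vec.
       (\<forall>s<m. \<psi> s \<in> carrier_vec n \<and> \<psi> s \<noteq> 0\<^sub>v n) \<and>
       (\<forall>s<m. \<forall>t<m. s \<noteq> t \<longrightarrow> hs_orthogonal (ket_bra (\<psi> s) (\<psi> t)) S)}"

definition one_shot_capacity :: "nat \<Rightarrow> complex mat set \<Rightarrow> real" where
  "one_shot_capacity n S = log 2 (real (independence_number n S))"

definition zero_error_capacity :: "nat \<Rightarrow> complex mat set \<Rightarrow> real" where
  "zero_error_capacity n S =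
     lim (\<lambda>k. 1 / real k * one_shot_capacity (n ^ k) (nc_power n S k))"

definition capacity_activated ::
    "nat \<Rightarrow> complex mat set \<Rightarrow> nat \<Rightarrow> complex mat set \<Rightarrow> bool" where
  "capacity_activated n S m T \<longleftrightarrow>
     (zero_error_capacity n S = 0 \<or> zero_error_capacity m T = 0) \<and>
     zero_error_capacity (n * m) (nc_tensor n S m T) >
       zero_error_capacity n S + zero_error_capacity m T"

end

theory Submission
  imports Defs
begin

text \<open>Suppose that \<open>S\<close> is not scalar. It contains a nonscalar Hermitian matrix, so after a unitary
  change of basis it contains both diagonal matrix units. If all of \<open>S\<close> is diagonal, then compressing
  the first tensor factor to the two basis vectors gives \<open>\<alpha>(S \<otimes> T) = 2 \<alpha>(T)\<close>. Otherwise \<open>S\<close> contains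
  rank-one projections onto infinitely many lines; compressing to one of them that annihilates none of
  finitely many given vectors gives \<open>\<alpha>(S \<otimes> T) = \<alpha>(T)\<close>. Both compressions are compatible with tensor
  products, so \<open>\<alpha>((S \<otimes> T)\<^sup>\<otimes>\<^sup>k) = r\<^sup>k \<alpha>(T\<^sup>\<otimes>\<^sup>k)\<close> and \<open>\<alpha>(S\<^sup>\<otimes>\<^sup>k) = r\<^sup>k\<close> with \<open>r\<close> being 2 or 1, which leaves no
  room for activation.\<close>

section \<open>Kronecker products and operator spaces\<close>

text \<open>The independence number is not multiplicative, so its value on S alone says nothing
  about S \<otimes> T. What does multiply is the evidence for the two bounds: compressions for the
  upper one (\<open>covers\<close>) and isometries for the lower one (\<open>embeds\<close>), both
  of which can be tensored factor by factor. They must come in the same number r, since any gap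
  would be raised to the k-th power and survive in the capacity. This makes the off-diagonal case
  the delicate one. The two basis kets cover there as well, but with r = 2, while the lower bound is
  only 1. A single fixed line kills every vector orthogonal to it, so the line has to be chosen
  after the vectors are known. A compression to one dimension along a ket V is admissible exactly
  when the multiples of V times its adjoint lie in S. Hence the search for rank-one elements of S;
  the scalar matrices contain none, which is why they are the exception.\<close>

lemma mat_adjoint_dim [simp]:
  "dim_row (mat_adjoint A) = dim_col A" "dim_col (mat_adjoint A) = dim_row A"
  by (simp_all add: mat_adjoint_def)

lemma mat_adjoint_carrier [simp, intro]:
  "A \<in> carrier_mat n m \<Longrightarrow> mat_adjoint A \<in> carrier_mat m n"
  by (rule carrier_matI) simp_all

lemma mat_adjoint_index [simp]:
  fixes A :: "complex mat"
  assumes "i < dim_col A" "j < dim_row A"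
  shows "mat_adjoint A $$ (i, j) = cnj (A $$ (j, i))"
proof -
  have "conjugate (col A i) $ j = cnj (A $$ (j, i))"
    using assms by simp
  then show ?thesis using assms unfolding mat_adjoint_def by (subst mat_of_rows_index) simp_all
qed

lemma mat_adjoint_adjoint [simp]: "mat_adjoint (mat_adjoint A) = (A :: complex mat)"
  by (rule eq_matI) simp_all

lemma mat_adjoint_one [simp]: "mat_adjoint (1\<^sub>m n :: complex mat) = 1\<^sub>m n"
  by (rule eq_matI) auto

lemma mat_adjoint_mult:
  fixes A B :: "complex mat"
  assumes "A \<in> carrier_mat n m" "B \<in> carrier_mat m l"
  shows "mat_adjoint (A * B) = mat_adjoint B * mat_adjoint A"
proof (rule eq_matI)
  fix i j assume "i < dim_row (mat_adjoint B * mat_adjoint A)" "j < dim_col (mat_adjoint B * mat_adjoint A)"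
  then show "mat_adjoint (A * B) $$ (i, j) = (mat_adjoint B * mat_adjoint A) $$ (i, j)"
    using assms by (auto simp: scalar_prod_def intro!: sum.cong)
qed (use assms in auto)

lemma kronecker_dim [simp]:
  "dim_row (kronecker A B) = dim_row A * dim_row B"
  "dim_col (kronecker A B) = dim_col A * dim_col B"
  by (auto simp: kronecker_def)

lemma kronecker_carrier [simp, intro]:
  "A \<in> carrier_mat n m \<Longrightarrow> B \<in> carrier_mat k l \<Longrightarrow> kronecker A B \<in> carrier_mat (n * k) (m * l)"
  by (rule carrier_matI) auto

lemma kronecker_index [simp]:
  "i < dim_row A * dim_row B \<Longrightarrow> j < dim_col A * dim_col B \<Longrightarrow>
    kronecker A B $$ (i, j) =
      A $$ (i div dim_row B, j div dim_col B) * B $$ (i mod dim_row B, j mod dim_col B)"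
  by (simp add: kronecker_def)

lemma mod_less_of_less_mult: "i < a * b \<Longrightarrow> i mod b < (b :: nat)"
  by (cases "b = 0") auto

lemma mult_add_less: "i < a \<Longrightarrow> j < b \<Longrightarrow> i * b + j < a * (b :: nat)"
proof -
  assume "i < a" "j < b"
  then have "i * b + j < Suc i * b" by simp
  also have "\<dots> \<le> a * b" using \<open>i < a\<close> by (intro mult_le_mono1) simp
  finally show ?thesis .
qed

text \<open>An index of the tensor space is a pair, coded by quotient and remainder; this turns one
  sum over it into a double sum over the two factors.\<close>

lemma sum_div_mod:
  fixes f :: "nat \<Rightarrow> nat \<Rightarrow> 'a :: comm_monoid_add"
  shows "(\<Sum>k<a * b. f (k div b) (k mod b)) = (\<Sum>i<a. \<Sum>j<b. f i j)"
proof -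
  have "(\<Sum>i<a. \<Sum>j<b. f i j) = (\<Sum>(i, j)\<in>{..<a} \<times> {..<b}. f i j)"
    by (simp add: sum.cartesian_product)
  also have "\<dots> = (\<Sum>k<a * b. f (k div b) (k mod b))"
    by (rule sum.reindex_bij_witness[of _ "\<lambda>k. (k div b, k mod b)" "\<lambda>(i, j). i * b + j"])
       (auto simp: less_mult_imp_div_less mod_less_of_less_mult mult_add_less)
  finally show ?thesis by simp
qed

lemma kronecker_mult:
  fixes A B C D :: "complex mat"
  assumes "A \<in> carrier_mat n1 m1" "C \<in> carrier_mat m1 l1"
    and "B \<in> carrier_mat n2 m2" "D \<in> carrier_mat m2 l2"
  shows "kronecker A B * kronecker C D = kronecker (A * C) (B * D)"
proof (rule eq_matI)
  fix i j assume "i < dim_row (kronecker (A * C) (B * D))" "j < dim_col (kronecker (A * C) (B * D))"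
  then have ij: "i < n1 * n2" "j < l1 * l2" using assms by auto
  note b = less_mult_imp_div_less[OF ij(1)] less_mult_imp_div_less[OF ij(2)]
    mod_less_of_less_mult[OF ij(1)] mod_less_of_less_mult[OF ij(2)]
  have "(kronecker A B * kronecker C D) $$ (i, j) =
      (\<Sum>k<m1 * m2. (\<lambda>p q. (A $$ (i div n2, p) * C $$ (p, j div l2)) *
        (B $$ (i mod n2, q) * D $$ (q, j mod l2))) (k div m2) (k mod m2))"
    using assms ij
    by (simp add: scalar_prod_def lessThan_atLeast0 less_mult_imp_div_less mod_less_of_less_mult mult.left_commute mult.assoc)
  also have "\<dots> = (\<Sum>p<m1. A $$ (i div n2, p) * C $$ (p, j div l2)) *
      (\<Sum>q<m2. B $$ (i mod n2, q) * D $$ (q, j mod l2))"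
    by (subst sum_div_mod) (simp add: sum_product)
  also have "\<dots> = kronecker (A * C) (B * D) $$ (i, j)"
    using assms ij b by (auto simp: scalar_prod_def lessThan_atLeast0)
  finally show "(kronecker A B * kronecker C D) $$ (i, j) = kronecker (A * C) (B * D) $$ (i, j)" .
qed (use assms in auto)

lemma mat_adjoint_kronecker:
  "mat_adjoint (kronecker A B) = kronecker (mat_adjoint A) (mat_adjoint B)"
  by (rule eq_matI)
     (auto simp: less_mult_imp_div_less mod_less_of_less_mult)

lemma kronecker_one: "kronecker (1\<^sub>m n) (1\<^sub>m m) = 1\<^sub>m (n * m)"
proof (rule eq_matI)
  fix i j assume "i < dim_row (1\<^sub>m (n * m) :: complex mat)" "j < dim_col (1\<^sub>m (n * m) :: complex mat)"
  then have ij: "i < n * m" "j < n * m" by auto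
  have "i = j" if "i div m = j div m" "i mod m = j mod m"
    using that by (metis div_mult_mod_eq)
  with ij show "kronecker (1\<^sub>m n) (1\<^sub>m m) $$ (i, j) = 1\<^sub>m (n * m) $$ (i, j)"
    by (auto simp: less_mult_imp_div_less mod_less_of_less_mult)
qed auto

lemma kronecker_zero_left: "B \<in> carrier_mat k l \<Longrightarrow> kronecker (0\<^sub>m n m) B = 0\<^sub>m (n * k) (m * l)"
  by (rule eq_matI) (auto simp: less_mult_imp_div_less)

lemma kronecker_zero_right: "A \<in> carrier_mat n m \<Longrightarrow> kronecker A (0\<^sub>m k l) = 0\<^sub>m (n * k) (m * l)"
  by (rule eq_matI) (auto simp: mod_less_of_less_mult)

lemma kronecker_unit_dim_left:
  "c \<in> carrier_mat 1 1 \<Longrightarrow> kronecker c B = (c $$ (0, 0)) \<cdot>\<^sub>m B"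
  by (rule eq_matI) auto

text \<open>Linearity carries spans and scalings, and the identity makes independent families
  orthogonal. Closure under adjoints is a separate hypothesis of the qubit lemmas that build
  Hermitian elements.\<close>

definition op_space :: "nat \<Rightarrow> complex mat set \<Rightarrow> bool" where
  "op_space n G \<longleftrightarrow> submodule class_ring G (operators n) \<and> 1\<^sub>m n \<in> G"

lemma operators_module: "Module.module class_ring (operators n)"
  using matrix_vs[of n n, where 'a = complex] by (simp add: vectorspace_def)

lemma submodule_operatorsI:
  assumes "G \<subseteq> carrier_mat n n" "0\<^sub>m n n \<in> G"
    and "\<And>A B. A \<in> G \<Longrightarrow> B \<in> G \<Longrightarrow> A + B \<in> G"
    and "\<And>c A. A \<in> G \<Longrightarrow> c \<cdot>\<^sub>m A \<in> G"
  shows "submodule class_ring G (operators n)"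
  using assms operators_module unfolding submodule_def by (simp add: module_mat_simps)

lemma op_spaceI:
  assumes "G \<subseteq> carrier_mat n n" "1\<^sub>m n \<in> G"
    and "\<And>A B. A \<in> G \<Longrightarrow> B \<in> G \<Longrightarrow> A + B \<in> G"
    and "\<And>c A. A \<in> G \<Longrightarrow> c \<cdot>\<^sub>m A \<in> G"
  shows "op_space n G"
proof -
  have "0 \<cdot>\<^sub>m 1\<^sub>m n \<in> G" using assms by blast
  moreover have "0 \<cdot>\<^sub>m 1\<^sub>m n = (0\<^sub>m n n :: complex mat)" by auto
  ultimately show ?thesis unfolding op_space_def
    using assms by (auto intro!: submodule_operatorsI)
qed

lemma op_spaceD:
  assumes "op_space n G"
  shows "G \<subseteq> carrier_mat n n" "1\<^sub>m n \<in> G" "0\<^sub>m n n \<in> G"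
    and "A \<in> G \<Longrightarrow> B \<in> G \<Longrightarrow> A + B \<in> G"
    and "A \<in> G \<Longrightarrow> c \<cdot>\<^sub>m A \<in> G"
  using assms unfolding op_space_def submodule_def by (simp_all add: module_mat_simps)

lemma nc_graph_op_space: "nc_graph n S \<Longrightarrow> op_space n S"
  by (simp add: nc_graph_def op_space_def VectorSpace.subspace_def)

lemma op_space_unit_dim: "op_space 1 (carrier_mat 1 1)"
  by (rule op_spaceI) auto

text \<open>The span in \<open>nc_tensor\<close> is unfolded only here. Later arguments use that it
  is a submodule, contains the products, and is the least such.\<close>

lemma
  assumes S: "S \<subseteq> carrier_mat n n" and T: "T \<subseteq> carrier_mat m m"
  shows nc_tensor_submodule: "submodule class_ring (nc_tensor n S m T) (operators (n * m))"
    and kronecker_in_nc_tensor: "P \<in> S \<Longrightarrow> Q \<in> T \<Longrightarrow> kronecker P Q \<in> nc_tensor n S m T"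
    and nc_tensor_subset: "submodule class_ring N (operators (n * m)) \<Longrightarrow>
      (\<And>P Q. P \<in> S \<Longrightarrow> Q \<in> T \<Longrightarrow> kronecker P Q \<in> N) \<Longrightarrow> nc_tensor n S m T \<subseteq> N"
proof -
  interpret Module.module class_ring "operators (n * m)" by (rule operators_module)
  have X: "{kronecker P Q | P Q. P \<in> S \<and> Q \<in> T} \<subseteq> carrier (operators (n * m))"
    using S T by (auto simp: module_mat_simps)
  show "submodule class_ring (nc_tensor n S m T) (operators (n * m))"
    unfolding nc_tensor_def by (rule span_is_submodule[OF X])
  show "P \<in> S \<Longrightarrow> Q \<in> T \<Longrightarrow> kronecker P Q \<in> nc_tensor n S m T"
    unfolding nc_tensor_def using in_own_span[OF X] by blast
  show "nc_tensor n S m T \<subseteq> N" if "submodule class_ring N (operators (n * m))"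
    "\<And>P Q. P \<in> S \<Longrightarrow> Q \<in> T \<Longrightarrow> kronecker P Q \<in> N"
    unfolding nc_tensor_def by (rule span_is_subset[OF _ that(1)]) (use that(2) in auto)
qed

lemma nc_tensor_op_space:
  assumes "op_space n S" "op_space m T"
  shows "op_space (n * m) (nc_tensor n S m T)"
  unfolding op_space_def
  using nc_tensor_submodule[of S n T m] kronecker_in_nc_tensor[of S n T m "1\<^sub>m n" "1\<^sub>m m"]
    assms[THEN op_spaceD(1)] assms[THEN op_spaceD(2)] kronecker_one[of n m] by auto

lemma nc_power_op_space: "op_space n S \<Longrightarrow> op_space (n ^ k) (nc_power n S k)"
proof (induction k)
  case (Suc k)
  then show ?case using nc_tensor_op_space[of "n ^ k" "nc_power n S k" n S] by (simp add: mult.commute)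
qed (use op_space_unit_dim in simp)

text \<open>The map \<open>Y\<close> to \<open>V * Y * W\<close> is linear, so the preimage of
  \<open>N\<close> is a submodule, and it suffices to test Kronecker products. \<open>W\<close> is
  independent of \<open>V\<close> because the off-diagonal blocks in \<open>embeds\<close> have two
  different isometries on the two sides.\<close>

lemma nc_tensor_conj_subset:
  assumes S: "op_space n S" "op_space m T" and V: "V \<in> carrier_mat k (n * m)"
    and N: "submodule class_ring N (operators k)"
    and gen: "\<And>P Q. P \<in> S \<Longrightarrow> Q \<in> T \<Longrightarrow> V * kronecker P Q * W \<in> N"
    and W: "W \<in> carrier_mat (n * m) k"
    and Y: "Y \<in> nc_tensor n S m T"
  shows "V * Y * W \<in> N"
proof -
  have N': "0\<^sub>m k k \<in> N" "\<And>A B. A \<in> N \<Longrightarrow> B \<in> N \<Longrightarrow> A + B \<in> N" "\<And>c A. A \<in> N \<Longrightarrow> c \<cdot>\<^sub>m A \<in> N"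
    using N unfolding submodule_def by (simp_all add: module_mat_simps)
  have "submodule class_ring {Y \<in> carrier_mat (n * m) (n * m). V * Y * W \<in> N} (operators (n * m))"
  proof (rule submodule_operatorsI)
    fix A B assume "A \<in> {Y \<in> carrier_mat (n * m) (n * m). V * Y * W \<in> N}"
      "B \<in> {Y \<in> carrier_mat (n * m) (n * m). V * Y * W \<in> N}"
    then show "A + B \<in> {Y \<in> carrier_mat (n * m) (n * m). V * Y * W \<in> N}"
      using V W N'(2)
      by (auto simp: mult_add_distrib_mat[of _ k "n * m" _ "n * m"]
        add_mult_distrib_mat[of _ k "n * m" _ _ k])
  next
    fix A c assume "A \<in> {Y \<in> carrier_mat (n * m) (n * m). V * Y * W \<in> N}"
    then show "c \<cdot>\<^sub>m A \<in> {Y \<in> carrier_mat (n * m) (n * m). V * Y * W \<in> N}"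
      using V W N'(3)
      by (auto simp: mult_smult_distrib[of _ k "n * m" _ "n * m"]
        mult_smult_assoc_mat[of _ k "n * m" _ k])
  qed (use V W N' in auto)
  then have "nc_tensor n S m T \<subseteq> {Y \<in> carrier_mat (n * m) (n * m). V * Y * W \<in> N}"
    by (rule nc_tensor_subset[rotated 2])
       (use S[THEN op_spaceD(1)] gen in auto)
  with Y show ?thesis by auto
qed

section \<open>Independent families\<close>

lemma zero_mult_mat_vec: "v \<in> carrier_vec m \<Longrightarrow> 0\<^sub>m n m *\<^sub>v v = (0\<^sub>v n :: 'a :: semiring_0 vec)"
  by (intro eq_vecI) (auto simp: scalar_prod_def)

text \<open>The trace of a rank-one operator times \<open>Y\<close> is a matrix element of
  \<open>Y\<close>. As \<open>\<bullet>c\<close> conjugates its second argument, the right side is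
  the element of \<open>Y\<close> between bra v and ket w.\<close>

lemma hs_inner_ket_bra:
  assumes "v \<in> carrier_vec n" "w \<in> carrier_vec n" "Y \<in> carrier_mat n n"
  shows "hs_inner (ket_bra v w) Y = (Y *\<^sub>v w) \<bullet>c v"
proof -
  have K: "ket_bra v w \<in> carrier_mat n n" using assms by (simp add: ket_bra_def)
  have "hs_inner (ket_bra v w) Y = (\<Sum>i<n. \<Sum>k<n. cnj (v $ k * cnj (w $ i)) * Y $$ (k, i))"
    unfolding hs_inner_def mat_trace_def
    using K assms by (auto simp: scalar_prod_def lessThan_atLeast0 ket_bra_def intro!: sum.cong)
  also have "\<dots> = (\<Sum>k<n. \<Sum>i<n. cnj (v $ k * cnj (w $ i)) * Y $$ (k, i))"
    by (rule sum.swap)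
  also have "\<dots> = (Y *\<^sub>v w) \<bullet>c v"
    using assms by (auto simp: scalar_prod_def lessThan_atLeast0 sum_distrib_left mult_ac intro!: sum.cong)
  finally show ?thesis .
qed

lemma mult_mat_vec_adjoint:
  fixes V :: "complex mat"
  assumes "V \<in> carrier_mat n m" "x \<in> carrier_vec m" "y \<in> carrier_vec n"
  shows "(V *\<^sub>v x) \<bullet>c y = x \<bullet>c (mat_adjoint V *\<^sub>v y)"
proof -
  have "(V *\<^sub>v x) \<bullet>c y = (\<Sum>i<n. \<Sum>j<m. V $$ (i, j) * x $ j * cnj (y $ i))"
    using assms by (auto simp: scalar_prod_def lessThan_atLeast0 sum_distrib_right intro!: sum.cong)
  also have "\<dots> = (\<Sum>j<m. \<Sum>i<n. V $$ (i, j) * x $ j * cnj (y $ i))"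
    by (rule sum.swap)
  also have "\<dots> = x \<bullet>c (mat_adjoint V *\<^sub>v y)"
    using assms by (auto simp: scalar_prod_def lessThan_atLeast0 sum_distrib_left mult_ac intro!: sum.cong)
  finally show ?thesis .
qed

text \<open>Arbitrary index sets allow surviving subfamilies (for the upper bound) and products with
  \<open>{..<r}\<close> (for the lower bound) without renumbering.\<close>

definition indep_family ::
    "nat \<Rightarrow> complex mat set \<Rightarrow> 'a set \<Rightarrow> ('a \<Rightarrow> complex vec) \<Rightarrow> bool" where
  "indep_family n G A \<psi> \<longleftrightarrow>
     (\<forall>a\<in>A. \<psi> a \<in> carrier_vec n \<and> \<psi> a \<noteq> 0\<^sub>v n) \<and>
     (\<forall>a\<in>A. \<forall>b\<in>A. a \<noteq> b \<longrightarrow> (\<forall>Y\<in>G. (Y *\<^sub>v \<psi> b) \<bullet>c \<psi> a = 0))"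

text \<open>If \<open>m > n\<close>, pad the vectors with zeros to the columns of a square matrix
  \<open>A\<close>. The Gram matrix of \<open>A\<close> is diagonal with nonzero entries, hence
  invertible, but \<open>A\<close> has a zero row.\<close>

lemma indep_family_card_le_dim:
  assumes one: "1\<^sub>m n \<in> G" and ind: "indep_family n G {..<m} \<psi>"
  shows "m \<le> n"
proof (rule ccontr)
  assume "\<not> m \<le> n"
  define A where "A = mat m m (\<lambda>(i, j). if i < n then \<psi> j $ i else 0)"
  have A: "A \<in> carrier_mat m m" by (simp add: A_def)
  have c: "\<psi> j \<in> carrier_vec n" if "j < m" for j
    using ind that by (auto simp: indep_family_def)
  have entry: "(mat_adjoint A * A) $$ (i, j) = \<psi> j \<bullet>c \<psi> i" if ij: "i < m" "j < m" for i j
  proof -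
    have "(mat_adjoint A * A) $$ (i, j) = (\<Sum>k<m. cnj (A $$ (k, i)) * A $$ (k, j))"
      using A ij by (auto simp: scalar_prod_def lessThan_atLeast0 intro!: sum.cong)
    also have "\<dots> = (\<Sum>k<n. cnj (A $$ (k, i)) * A $$ (k, j))"
      using \<open>\<not> m \<le> n\<close> ij by (intro sum.mono_neutral_right) (auto simp: A_def)
    also have "\<dots> = \<psi> j \<bullet>c \<psi> i"
      using \<open>\<not> m \<le> n\<close> ij c[OF ij(1)] c[OF ij(2)]
      by (auto simp: A_def scalar_prod_def lessThan_atLeast0 mult.commute intro!: sum.cong)
    finally show ?thesis .
  qed
  have off: "(mat_adjoint A * A) $$ (i, j) = 0" if "i < m" "j < m" "i \<noteq> j" for i j
  proof -
    have "(1\<^sub>m n *\<^sub>v \<psi> j) \<bullet>c \<psi> i = 0"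
      using ind that one unfolding indep_family_def by blast
    then show ?thesis using entry[OF that(1,2)] c[OF that(2)] by simp
  qed
  have diag: "(mat_adjoint A * A) $$ (i, i) \<noteq> 0" if "i < m" for i
    using entry[OF that that] ind that conjugate_square_eq_0_vec[OF c[OF that]]
    by (auto simp: indep_family_def)
  have B: "mat_adjoint A * A \<in> carrier_mat m m" using A by (intro mult_carrier_mat) auto
  have "det (mat_adjoint A * A) = prod_list (diag_mat (mat_adjoint A * A))"
    using off B by (intro det_upper_triangular[OF upper_triangularI]) auto
  then have "det (mat_adjoint A * A) \<noteq> 0"
    using diag A by (auto simp: diag_mat_def prod_list_zero_iff)
  \<comment> \<open>Row \<open>n\<close> of \<open>A\<close> is the first padded row, so the adjoint
    kills the unit vector with index \<open>n\<close>.\<close>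
  moreover have "mat_adjoint A *\<^sub>v unit_vec m n = 0\<^sub>v m"
    using \<open>\<not> m \<le> n\<close> A by (auto simp: A_def intro!: eq_vecI)
  then have "det (mat_adjoint A) = 0"
    using det_0_iff_vec_prod_zero[OF mat_adjoint_carrier[OF A]] \<open>\<not> m \<le> n\<close>
    by (metis linorder_not_le unit_vec_carrier unit_vec_nonzero)
  ultimately show False using det_mult[OF mat_adjoint_carrier[OF A] A] by simp
qed

lemma indep_family_reindex:
  "indep_family n G A \<psi> \<Longrightarrow> inj_on f B \<Longrightarrow> f ` B \<subseteq> A \<Longrightarrow> indep_family n G B (\<psi> \<circ> f)"
  unfolding indep_family_def inj_on_def image_subset_iff comp_def by metis

lemma independence_number_eq:
  assumes "op_space n G"
  shows "independence_number n G = Max {m. \<exists>\<psi>. indep_family n G {..<m} \<psi>}"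
proof -
  have "(\<forall>s<m. \<psi> s \<in> carrier_vec n \<and> \<psi> s \<noteq> 0\<^sub>v n) \<and>
      (\<forall>s<m. \<forall>t<m. s \<noteq> t \<longrightarrow> hs_orthogonal (ket_bra (\<psi> s) (\<psi> t)) G) \<longleftrightarrow>
      indep_family n G {..<m} \<psi>" for m and \<psi> :: "nat \<Rightarrow> complex vec"
  proof -
    have "hs_orthogonal (ket_bra (\<psi> s) (\<psi> t)) G \<longleftrightarrow> (\<forall>Y\<in>G. (Y *\<^sub>v \<psi> t) \<bullet>c \<psi> s = 0)"
      if "\<psi> s \<in> carrier_vec n" "\<psi> t \<in> carrier_vec n" for s t
      using op_spaceD(1)[OF assms] that hs_inner_ket_bra[of "\<psi> s" n "\<psi> t"]
      unfolding hs_orthogonal_def by (metis subsetD)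
    then show ?thesis unfolding indep_family_def by (auto 4 3)
  qed
  then show ?thesis unfolding independence_number_def by simp
qed

text \<open>\<open>Max\<close> is informative only on a finite nonempty set: the dimension bound
  gives finiteness, the empty family gives nonemptiness.\<close>

lemma
  assumes "op_space n G"
  shows indep_family_card_le: "finite A \<Longrightarrow> indep_family n G A \<psi> \<Longrightarrow> card A \<le> independence_number n G"
    and independence_number_attained: "\<exists>\<phi>. indep_family n G {..<independence_number n G} \<phi>"
    and independence_number_le: "independence_number n G \<le> n"
proof -
  let ?M = "{m :: nat. \<exists>\<phi>. indep_family n G {..<m} \<phi>}"
  have le: "?M \<subseteq> {..n}"
    using indep_family_card_le_dim[OF op_spaceD(2)[OF assms]] by auto
  then have fin: "finite ?M" by (rule finite_subset) simp
  have ne: "0 \<in> ?M" by (simp add: indep_family_def)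
  have "Max ?M \<in> ?M" using Max_in[OF fin] ne by blast
  then show "\<exists>\<phi>. indep_family n G {..<independence_number n G} \<phi>"
    and "independence_number n G \<le> n"
    using le unfolding independence_number_eq[OF assms] by auto
  show "card A \<le> independence_number n G" if A: "finite A" "indep_family n G A \<psi>"
  proof -
    obtain f where "bij_betw f {..<card A} A"
      using ex_bij_betw_nat_finite[OF A(1)] by (auto simp: lessThan_atLeast0)
    then have "indep_family n G {..<card A} (\<psi> \<circ> f)"
      using indep_family_reindex[OF A(2)] by (auto simp: bij_betw_def)
    then show ?thesis unfolding independence_number_eq[OF assms]
      using Max_ge[OF fin] by blast
  qed
qed

lemma independence_number_pos:
  assumes "op_space n G" "n > 0"
  shows "independence_number n G \<ge> 1"
proof -
  have "indep_family n G {()} (\<lambda>_. unit_vec n 0)"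
    using assms(2) by (auto simp: indep_family_def)
  from indep_family_card_le[OF assms(1) _ this] show ?thesis by simp
qed

text \<open>The matrices \<open>V\<close> compress independent families of \<open>G\<close> to independent families of \<open>H\<close>, since
  \<open>\<langle>V\<^sup>* \<psi>, Y V\<^sup>* \<phi>\<rangle> = \<langle>\<psi>, V Y V\<^sup>* \<phi>\<rangle>\<close>. They may depend on the finite set \<open>\<Psi>\<close> of vectors: only this
  makes \<open>r = 1\<close> possible for qubit graphs of dimension at least 3.\<close>
definition covers ::
    "nat \<Rightarrow> nat \<Rightarrow> complex mat set \<Rightarrow> nat \<Rightarrow> complex mat set \<Rightarrow> bool" where
  "covers r n G m H \<longleftrightarrow>
     (\<forall>\<Psi>. finite \<Psi> \<longrightarrow> \<Psi> \<subseteq> carrier_vec n - {0\<^sub>v n} \<longrightarrow>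
       (\<exists>\<V>. finite \<V> \<and> card \<V> \<le> r \<and> \<V> \<subseteq> carrier_mat n m \<and>
         (\<forall>V\<in>\<V>. \<forall>Y\<in>H. V * Y * mat_adjoint V \<in> G) \<and>
         (\<forall>\<psi>\<in>\<Psi>. \<exists>V\<in>\<V>. mat_adjoint V *\<^sub>v \<psi> \<noteq> 0\<^sub>v m)))"

text \<open>Every index of an optimal family of \<open>G\<close> survives under some
  \<open>V\<close>, and the survivors of one \<open>V\<close> form an independent family of
  \<open>H\<close>. So at most r bins hold all indices, each bin at most \<alpha>(H) of
  them.\<close>

lemma covers_independence_number_le:
  assumes cov: "covers r n G m H" and G: "op_space n G" and H: "op_space m H"
  shows "independence_number n G \<le> r * independence_number m H"
proof -
  define I where "I = {..<independence_number n G}"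
  have [simp]: "finite I" by (simp add: I_def)
  obtain \<psi> where \<psi>: "indep_family n G I \<psi>"
    using independence_number_attained[OF G] unfolding I_def by blast
  have \<psi>c: "\<psi> a \<in> carrier_vec n" if "a \<in> I" for a using \<psi> that by (auto simp: indep_family_def)
  have "finite (\<psi> ` I)" "\<psi> ` I \<subseteq> carrier_vec n - {0\<^sub>v n}"
    using \<psi> by (auto simp: indep_family_def)
  with cov obtain \<V> where \<V>: "finite \<V>" "card \<V> \<le> r" "\<V> \<subseteq> carrier_mat n m"
    "\<And>V Y. V \<in> \<V> \<Longrightarrow> Y \<in> H \<Longrightarrow> V * Y * mat_adjoint V \<in> G"
    "\<And>a. a \<in> I \<Longrightarrow> \<exists>V\<in>\<V>. mat_adjoint V *\<^sub>v \<psi> a \<noteq> 0\<^sub>v m"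
    unfolding covers_def by (metis (no_types, lifting) imageI)
  define B where "B V = {a \<in> I. mat_adjoint V *\<^sub>v \<psi> a \<noteq> 0\<^sub>v m}" for V
  have "card (B V) \<le> independence_number m H" if "V \<in> \<V>" for V
  proof (rule indep_family_card_le[OF H])
    have V: "V \<in> carrier_mat n m" using that \<V> by blast
    have "(Y *\<^sub>v (mat_adjoint V *\<^sub>v \<psi> b)) \<bullet>c (mat_adjoint V *\<^sub>v \<psi> a) = 0"
      if ab: "a \<in> I" "b \<in> I" "a \<noteq> b" and Y: "Y \<in> H" for a b Y
    proof -
      have Yc: "Y \<in> carrier_mat m m" using Y op_spaceD(1)[OF H] by blast
      have "(Y *\<^sub>v (mat_adjoint V *\<^sub>v \<psi> b)) \<bullet>c (mat_adjoint V *\<^sub>v \<psi> a) =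
          (V *\<^sub>v (Y *\<^sub>v (mat_adjoint V *\<^sub>v \<psi> b))) \<bullet>c \<psi> a"
        using V Yc \<psi>c ab by (intro mult_mat_vec_adjoint[symmetric]) (auto intro!: mult_mat_vec_carrier)
      also have "V *\<^sub>v (Y *\<^sub>v (mat_adjoint V *\<^sub>v \<psi> b)) = (V * Y * mat_adjoint V) *\<^sub>v \<psi> b"
        using V Yc \<psi>c[OF ab(2)]
        by (subst assoc_mult_mat_vec[of _ n m _ n], auto simp del: assoc_mult_mat)
           (subst assoc_mult_mat_vec[of _ n m _ m], auto intro!: mult_mat_vec_carrier)
      also have "\<dots> \<bullet>c \<psi> a = 0"
        using \<psi> ab \<V>(4)[OF \<open>V \<in> \<V>\<close> Y] by (auto simp: indep_family_def)
      finally show ?thesis .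
    qed
    then show "indep_family m H (B V) (\<lambda>a. mat_adjoint V *\<^sub>v \<psi> a)"
      using V \<psi>c by (auto simp: indep_family_def B_def intro!: mult_mat_vec_carrier)
  qed (simp add: B_def)
  then have "(\<Sum>V\<in>\<V>. card (B V)) \<le> (\<Sum>V\<in>\<V>. independence_number m H)"
    by (rule sum_mono)
  moreover have "I \<subseteq> (\<Union>V\<in>\<V>. B V)" using \<V>(5) by (auto simp: B_def)
  then have "card I \<le> card (\<Union>V\<in>\<V>. B V)"
    using \<V>(1) by (intro card_mono) (auto simp: B_def)
  moreover have "card (\<Union>V\<in>\<V>. B V) \<le> (\<Sum>V\<in>\<V>. card (B V))"
    using \<V>(1) by (rule card_UN_le)
  moreover have "card \<V> * independence_number m H \<le> r * independence_number m H"
    using \<V>(2) by (rule mult_le_mono1)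
  ultimately show ?thesis unfolding I_def sum_constant card_lessThan of_nat_id by linarith
qed

text \<open>Each \<open>E i\<close> places a copy of an \<open>H\<close>-independent family in the
  larger space. The condition for \<open>i = j\<close> keeps every copy independent; the vanishing
  blocks for different \<open>i\<close>, \<open>j\<close> make the copies independent of each
  other.\<close>

definition embeds ::
    "nat \<Rightarrow> nat \<Rightarrow> complex mat set \<Rightarrow> nat \<Rightarrow> complex mat set \<Rightarrow> bool" where
  "embeds r n G m H \<longleftrightarrow>
     (\<exists>E. (\<forall>i<r. E i \<in> carrier_mat n m \<and> mat_adjoint (E i) * E i = 1\<^sub>m m) \<and>
       (\<forall>i<r. \<forall>j<r. \<forall>Y\<in>G.
         (if i = j then mat_adjoint (E i) * Y * E j \<in> H else mat_adjoint (E i) * Y * E j = 0\<^sub>m m m)))"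

lemma embeds_independence_number_ge:
  assumes emb: "embeds r n G m H" and G: "op_space n G" and H: "op_space m H"
  shows "r * independence_number m H \<le> independence_number n G"
proof -
  define I where "I = {..<independence_number m H}"
  obtain \<psi> where \<psi>: "indep_family m H I \<psi>"
    using independence_number_attained[OF H] unfolding I_def by blast
  have \<psi>c: "\<psi> a \<in> carrier_vec m" if "a \<in> I" for a using \<psi> that by (auto simp: indep_family_def)
  obtain E where E: "\<And>i. i < r \<Longrightarrow> E i \<in> carrier_mat n m"
    "\<And>i. i < r \<Longrightarrow> mat_adjoint (E i) * E i = 1\<^sub>m m"
    "\<And>i Y. i < r \<Longrightarrow> Y \<in> G \<Longrightarrow> mat_adjoint (E i) * Y * E i \<in> H"
    "\<And>i j Y. i < r \<Longrightarrow> j < r \<Longrightarrow> Y \<in> G \<Longrightarrow> i \<noteq> j \<Longrightarrow> mat_adjoint (E i) * Y * E j = 0\<^sub>m m m"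
    using emb unfolding embeds_def by metis
  have nz: "E i *\<^sub>v \<psi> a \<in> carrier_vec n \<and> E i *\<^sub>v \<psi> a \<noteq> 0\<^sub>v n"
    if i: "i \<in> {..<r}" and a: "a \<in> I" for i a
    proof
      show "E i *\<^sub>v \<psi> a \<in> carrier_vec n"
        using E(1) i \<psi>c[OF a] by (auto intro!: mult_mat_vec_carrier)
      have "mat_adjoint (E i) *\<^sub>v (E i *\<^sub>v \<psi> a) = (mat_adjoint (E i) * E i) *\<^sub>v \<psi> a"
        using E(1) i \<psi>c[OF a] by (intro assoc_mult_mat_vec[symmetric]) auto
      also have "\<dots> = \<psi> a" using E(2) i \<psi>c[OF a] by simp
      finally have "mat_adjoint (E i) *\<^sub>v (E i *\<^sub>v \<psi> a) \<noteq> 0\<^sub>v m"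
        using \<psi> a by (auto simp: indep_family_def)
      moreover have "mat_adjoint (E i) *\<^sub>v 0\<^sub>v n = 0\<^sub>v m"
        using mat_adjoint_carrier[OF E(1), of i] i by (intro eq_vecI) (auto simp: scalar_prod_def)
      ultimately show "E i *\<^sub>v \<psi> a \<noteq> 0\<^sub>v n" by auto
    qed
  have orth: "(Y *\<^sub>v (E j *\<^sub>v \<psi> b)) \<bullet>c (E i *\<^sub>v \<psi> a) = 0"
    if i: "i \<in> {..<r}" "j \<in> {..<r}" and ab: "a \<in> I" "b \<in> I" and Y: "Y \<in> G"
      and ne: "(i, a) \<noteq> (j, b)" for i a j b Y
  proof -
    have Yc: "Y \<in> carrier_mat n n" using Y op_spaceD(1)[OF G] by blast
    have c: "E i \<in> carrier_mat n m" "E j \<in> carrier_mat n m" using E(1) i by auto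
    have "(Y *\<^sub>v (E j *\<^sub>v \<psi> b)) \<bullet>c (E i *\<^sub>v \<psi> a) =
        (mat_adjoint (E i) *\<^sub>v (Y *\<^sub>v (E j *\<^sub>v \<psi> b))) \<bullet>c \<psi> a"
      using mult_mat_vec_adjoint[OF mat_adjoint_carrier[OF c(1)], of "Y *\<^sub>v (E j *\<^sub>v \<psi> b)" "\<psi> a"]
        c Yc \<psi>c ab by (simp add: mult_mat_vec_carrier[of _ n n] mult_mat_vec_carrier[of _ n m])
    also have "mat_adjoint (E i) *\<^sub>v (Y *\<^sub>v (E j *\<^sub>v \<psi> b)) = (mat_adjoint (E i) * Y * E j) *\<^sub>v \<psi> b"
      using c Yc \<psi>c[OF ab(2)]
      by (subst assoc_mult_mat_vec[of _ m n _ m], auto simp del: assoc_mult_mat)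
         (subst assoc_mult_mat_vec[of _ m n _ n], auto intro!: mult_mat_vec_carrier)
    also have "\<dots> \<bullet>c \<psi> a = 0"
    proof (cases "i = j")
      case True
      then have "mat_adjoint (E i) * Y * E j \<in> H" "a \<noteq> b" using E(3) i Y ne by auto
      then show ?thesis using \<psi> ab by (auto simp: indep_family_def)
    next
      case False
      then have "mat_adjoint (E i) * Y * E j = 0\<^sub>m m m" using E(4) i Y by auto
      then show ?thesis using \<psi>c[OF ab(1)] \<psi>c[OF ab(2)] by (simp add: zero_mult_mat_vec)
    qed
    finally show ?thesis .
  qed
  have "indep_family n G ({..<r} \<times> I) (\<lambda>(i, a). E i *\<^sub>v \<psi> a)"
    unfolding indep_family_def using nz orth by auto
  from indep_family_card_le[OF G _ this] show ?thesis by (simp add: I_def card_cartesian_product)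
qed

section \<open>Tensor products and powers\<close>

text \<open>\<open>A\<close> acts first, on the slices with fixed second index, and leaves a vector
  on which \<open>B\<close> acts. This order matches the tensor cover, where the second compression
  is chosen after the first.\<close>

lemma kronecker_mult_vec_index:
  fixes A B :: "complex mat"
  assumes A: "A \<in> carrier_mat m1 n1" and B: "B \<in> carrier_mat m2 n2"
    and v: "v \<in> carrier_vec (n1 * n2)" and ab: "a < m1" "b < m2"
  shows "(kronecker A B *\<^sub>v v) $ (a * m2 + b) =
    (B *\<^sub>v vec n2 (\<lambda>y. (A *\<^sub>v vec n1 (\<lambda>x. v $ (x * n2 + y))) $ a)) $ b"
proof -
  have lt: "a * m2 + b < m1 * m2" by (rule mult_add_less[OF ab])
  have dm: "(a * m2 + b) div m2 = a" "(a * m2 + b) mod m2 = b" using ab by auto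
  have "(kronecker A B *\<^sub>v v) $ (a * m2 + b) =
      (\<Sum>k<n1 * n2. A $$ (a, k div n2) * B $$ (b, k mod n2) * v $ (k div n2 * n2 + k mod n2))"
    using A B v lt dm
    by (auto simp: scalar_prod_def lessThan_atLeast0 intro!: sum.cong)
  also have "\<dots> = (\<Sum>x<n1. \<Sum>y<n2. A $$ (a, x) * B $$ (b, y) * v $ (x * n2 + y))"
    by (rule sum_div_mod[of "\<lambda>x y. A $$ (a, x) * B $$ (b, y) * v $ (x * n2 + y)"])
  also have "\<dots> = (\<Sum>y<n2. \<Sum>x<n1. A $$ (a, x) * B $$ (b, y) * v $ (x * n2 + y))"
    by (rule sum.swap)
  also have "\<dots> = (B *\<^sub>v vec n2 (\<lambda>y. (A *\<^sub>v vec n1 (\<lambda>x. v $ (x * n2 + y))) $ a)) $ b"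
    using A B ab
    by (auto simp: scalar_prod_def lessThan_atLeast0 sum_distrib_left mult_ac intro!: sum.cong)
  finally show ?thesis .
qed

lemma kronecker_conj:
  fixes V V' P W W' Q :: "complex mat"
  assumes "V \<in> carrier_mat k1 n1" "P \<in> carrier_mat n1 m1" "V' \<in> carrier_mat m1 l1"
    and "W \<in> carrier_mat k2 n2" "Q \<in> carrier_mat n2 m2" "W' \<in> carrier_mat m2 l2"
  shows "kronecker V W * kronecker P Q * kronecker V' W' = kronecker (V * P * V') (W * Q * W')"
proof -
  have "kronecker V W * kronecker P Q = kronecker (V * P) (W * Q)"
    using assms by (intro kronecker_mult)
  moreover have "kronecker (V * P) (W * Q) * kronecker V' W' = kronecker (V * P * V') (W * Q * W')"
    using assms by (intro kronecker_mult mult_carrier_mat)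
  ultimately show ?thesis by simp
qed

lemma vec_nonzero_index: "v \<in> carrier_vec n \<Longrightarrow> v \<noteq> 0\<^sub>v n \<Longrightarrow> \<exists>i<n. v $ i \<noteq> 0"
  by (metis carrier_vecD eq_vecI index_zero_vec)

text \<open>A vector of the tensor space need not be a product, so survival is tested on slices. The
  vectors given to the second cover depend on the matrices returned by the first; this works because
  a cover answers every finite set of vectors with at most r matrices, however large the
  set.\<close>

lemma covers_tensor:
  assumes cov1: "covers r n G m H" and cov2: "covers r' n' G' m' H'"
    and G: "op_space n G" "op_space n' G'" and H: "op_space m H" "op_space m' H'"
  shows "covers (r * r') (n * n') (nc_tensor n G n' G') (m * m') (nc_tensor m H m' H')"
  unfolding covers_def
proof (intro allI impI)
  fix \<Psi> :: "complex vec set"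
  assume \<Psi>: "finite \<Psi>" "\<Psi> \<subseteq> carrier_vec (n * n') - {0\<^sub>v (n * n')}"
  \<comment> \<open>Apply the first cover to the slices of the vectors along the first tensor factor, and the
    second cover to the slices of the results along the second factor.\<close>
  define slice where "slice \<psi> y = vec n (\<lambda>x. \<psi> $ (x * n' + y))" for \<psi> :: "complex vec" and y
  \<comment> \<open>Zero slices are discarded because a cover is asked only about nonzero
    vectors.\<close>
  define \<Psi>1 where "\<Psi>1 = (\<lambda>(\<psi>, y). slice \<psi> y) ` (\<Psi> \<times> {..<n'}) - {0\<^sub>v n}"
  have "finite \<Psi>1" "\<Psi>1 \<subseteq> carrier_vec n - {0\<^sub>v n}"
    using \<Psi>(1) by (auto simp: \<Psi>1_def slice_def)
  with cov1 obtain \<V> where \<V>: "finite \<V>" "card \<V> \<le> r" "\<V> \<subseteq> carrier_mat n m"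
    "\<And>V Y. V \<in> \<V> \<Longrightarrow> Y \<in> H \<Longrightarrow> V * Y * mat_adjoint V \<in> G"
    "\<And>\<psi>. \<psi> \<in> \<Psi>1 \<Longrightarrow> \<exists>V\<in>\<V>. mat_adjoint V *\<^sub>v \<psi> \<noteq> 0\<^sub>v m"
    unfolding covers_def by metis
  define \<phi> where "\<phi> V \<psi> a = vec n' (\<lambda>y. (mat_adjoint V *\<^sub>v slice \<psi> y) $ a)"
    for V and \<psi> :: "complex vec" and a
  define \<Psi>2 where "\<Psi>2 = (\<lambda>(V, \<psi>, a). \<phi> V \<psi> a) ` (\<V> \<times> \<Psi> \<times> {..<m}) - {0\<^sub>v n'}"
  have "finite \<Psi>2" "\<Psi>2 \<subseteq> carrier_vec n' - {0\<^sub>v n'}"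
    using \<Psi>(1) \<V>(1) by (auto simp: \<Psi>2_def \<phi>_def)
  with cov2 obtain \<W> where \<W>: "finite \<W>" "card \<W> \<le> r'" "\<W> \<subseteq> carrier_mat n' m'"
    "\<And>W Y. W \<in> \<W> \<Longrightarrow> Y \<in> H' \<Longrightarrow> W * Y * mat_adjoint W \<in> G'"
    "\<And>\<psi>. \<psi> \<in> \<Psi>2 \<Longrightarrow> \<exists>W\<in>\<W>. mat_adjoint W *\<^sub>v \<psi> \<noteq> 0\<^sub>v m'"
    unfolding covers_def by metis
  define \<X> where "\<X> = (\<lambda>(V, W). kronecker V W) ` (\<V> \<times> \<W>)"
  have conj: "kronecker V W * Y * mat_adjoint (kronecker V W) \<in> nc_tensor n G n' G'"
    if V: "V \<in> \<V>" and W: "W \<in> \<W>" and Y: "Y \<in> nc_tensor m H m' H'" for V W Y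
  proof (rule nc_tensor_conj_subset[OF H _ _ _ _ Y])
    have c: "V \<in> carrier_mat n m" "W \<in> carrier_mat n' m'" using V W \<V> \<W> by auto
    then show "kronecker V W \<in> carrier_mat (n * n') (m * m')"
      "mat_adjoint (kronecker V W) \<in> carrier_mat (m * m') (n * n')" by auto
    show "submodule class_ring (nc_tensor n G n' G') (operators (n * n'))"
      using G by (intro nc_tensor_submodule op_spaceD)
    fix P Q assume PQ: "P \<in> H" "Q \<in> H'"
    then have "P \<in> carrier_mat m m" "Q \<in> carrier_mat m' m'" using H op_spaceD(1) by blast+
    with c have "kronecker V W * kronecker P Q * mat_adjoint (kronecker V W) =
        kronecker (V * P * mat_adjoint V) (W * Q * mat_adjoint W)"
      unfolding mat_adjoint_kronecker by (intro kronecker_conj) auto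
    also have "\<dots> \<in> nc_tensor n G n' G'"
      using \<V>(4)[OF V PQ(1)] \<W>(4)[OF W PQ(2)] G by (intro kronecker_in_nc_tensor op_spaceD(1))
    finally show "kronecker V W * kronecker P Q * mat_adjoint (kronecker V W) \<in> nc_tensor n G n' G'" .
  qed
  have nz: "\<exists>X\<in>\<X>. mat_adjoint X *\<^sub>v \<psi> \<noteq> 0\<^sub>v (m * m')" if \<psi>: "\<psi> \<in> \<Psi>" for \<psi>
  proof -
    have \<psi>c: "\<psi> \<in> carrier_vec (n * n')" using \<psi> \<Psi> by auto
    \<comment> \<open>One nonzero coordinate of \<open>\<psi>\<close> selects a nonzero slice; a
      nonzero coordinate \<open>a\<close> of its image under the adjoint of \<open>V\<close> makes
      \<open>\<phi> V \<psi> a\<close> nonzero, to which \<open>\<W>\<close> then applies.\<close>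
    obtain k where k: "k < n * n'" "\<psi> $ k \<noteq> 0"
      using vec_nonzero_index[OF \<psi>c] \<psi> \<Psi> by auto
    define y where "y = k mod n'"
    have y: "y < n'" using k(1) by (simp add: y_def mod_less_of_less_mult)
    have "slice \<psi> y $ (k div n') \<noteq> 0"
      using k by (simp add: slice_def y_def less_mult_imp_div_less)
    then have "slice \<psi> y \<noteq> 0\<^sub>v n" using less_mult_imp_div_less[OF k(1)] by auto
    then have "slice \<psi> y \<in> \<Psi>1" using y \<psi> by (auto simp: \<Psi>1_def)
    then obtain V where V: "V \<in> \<V>" "mat_adjoint V *\<^sub>v slice \<psi> y \<noteq> 0\<^sub>v m" using \<V>(5) by blast
    have Vc: "V \<in> carrier_mat n m" using V \<V> by auto
    have "mat_adjoint V *\<^sub>v slice \<psi> y \<in> carrier_vec m"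
      using mat_adjoint_carrier[OF Vc] by (intro mult_mat_vec_carrier) (auto simp: slice_def)
    then obtain a where a: "a < m" "(mat_adjoint V *\<^sub>v slice \<psi> y) $ a \<noteq> 0"
      using vec_nonzero_index V(2) by blast
    have "\<phi> V \<psi> a $ y \<noteq> 0" using a(2) y unfolding \<phi>_def by simp
    then have "\<phi> V \<psi> a \<noteq> 0\<^sub>v n'" using y by auto
    then have "\<phi> V \<psi> a \<in> \<Psi>2" using V(1) \<psi> a(1)
      by (auto simp: \<Psi>2_def intro!: image_eqI[of _ _ "(V, \<psi>, a)"])
    then obtain W where W: "W \<in> \<W>" "mat_adjoint W *\<^sub>v \<phi> V \<psi> a \<noteq> 0\<^sub>v m'" using \<W>(5) by blast
    have Wc: "W \<in> carrier_mat n' m'" using W \<W> by auto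
    have "mat_adjoint W *\<^sub>v \<phi> V \<psi> a \<in> carrier_vec m'"
      using mat_adjoint_carrier[OF Wc] by (intro mult_mat_vec_carrier) (auto simp: \<phi>_def)
    then obtain b where b: "b < m'" "(mat_adjoint W *\<^sub>v \<phi> V \<psi> a) $ b \<noteq> 0"
      using vec_nonzero_index W(2) by blast
    have "(mat_adjoint (kronecker V W) *\<^sub>v \<psi>) $ (a * m' + b) = (mat_adjoint W *\<^sub>v \<phi> V \<psi> a) $ b"
      unfolding mat_adjoint_kronecker \<phi>_def slice_def
      using Vc Wc \<psi>c a(1) b(1) by (intro kronecker_mult_vec_index) auto
    then have "mat_adjoint (kronecker V W) *\<^sub>v \<psi> \<noteq> 0\<^sub>v (m * m')"
      using b mult_add_less[OF a(1) b(1)] by auto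
    then show ?thesis using V(1) W(1) by (auto simp: \<X>_def)
  qed
  have "card \<X> \<le> card (\<V> \<times> \<W>)"
    unfolding \<X>_def using \<V>(1) \<W>(1) by (intro card_image_le) simp
  also have "\<dots> \<le> r * r'" using \<V>(2) \<W>(2) by (simp add: card_cartesian_product mult_le_mono)
  finally have "card \<X> \<le> r * r'" .
  moreover have "finite \<X>" "\<X> \<subseteq> carrier_mat (n * n') (m * m')"
    using \<V>(1,3) \<W>(1,3) unfolding \<X>_def by auto
  moreover have "\<forall>X\<in>\<X>. \<forall>Y\<in>nc_tensor m H m' H'. X * Y * mat_adjoint X \<in> nc_tensor n G n' G'"
    unfolding \<X>_def using conj by auto
  ultimately show "\<exists>\<V>. finite \<V> \<and> card \<V> \<le> r * r' \<and> \<V> \<subseteq> carrier_mat (n * n') (m * m') \<and>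
      (\<forall>V\<in>\<V>. \<forall>Y\<in>nc_tensor m H m' H'. V * Y * mat_adjoint V \<in> nc_tensor n G n' G') \<and>
      (\<forall>\<psi>\<in>\<Psi>. \<exists>V\<in>\<V>. mat_adjoint V *\<^sub>v \<psi> \<noteq> 0\<^sub>v (m * m'))"
    using nz by blast
qed

text \<open>The index \<open>i < r * r'\<close> codes a pair of isometries. Blocks of a Kronecker
  product are Kronecker products of blocks, and two distinct pairs differ in some component, where
  the block vanishes.\<close>

lemma embeds_tensor:
  assumes emb1: "embeds r n G m H" and emb2: "embeds r' n' G' m' H'"
    and G: "op_space n G" "op_space n' G'" and H: "op_space m H" "op_space m' H'"
  shows "embeds (r * r') (n * n') (nc_tensor n G n' G') (m * m') (nc_tensor m H m' H')"
proof -
  obtain E where E: "\<And>i. i < r \<Longrightarrow> E i \<in> carrier_mat n m"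
    "\<And>i. i < r \<Longrightarrow> mat_adjoint (E i) * E i = 1\<^sub>m m"
    "\<And>i Y. i < r \<Longrightarrow> Y \<in> G \<Longrightarrow> mat_adjoint (E i) * Y * E i \<in> H"
    "\<And>i j Y. i < r \<Longrightarrow> j < r \<Longrightarrow> Y \<in> G \<Longrightarrow> i \<noteq> j \<Longrightarrow> mat_adjoint (E i) * Y * E j = 0\<^sub>m m m"
    using emb1 unfolding embeds_def by metis
  obtain F where F: "\<And>i. i < r' \<Longrightarrow> F i \<in> carrier_mat n' m'"
    "\<And>i. i < r' \<Longrightarrow> mat_adjoint (F i) * F i = 1\<^sub>m m'"
    "\<And>i Y. i < r' \<Longrightarrow> Y \<in> G' \<Longrightarrow> mat_adjoint (F i) * Y * F i \<in> H'"
    "\<And>i j Y. i < r' \<Longrightarrow> j < r' \<Longrightarrow> Y \<in> G' \<Longrightarrow> i \<noteq> j \<Longrightarrow> mat_adjoint (F i) * Y * F j = 0\<^sub>m m' m'"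
    using emb2 unfolding embeds_def by metis
  define X where "X i = kronecker (E (i div r')) (F (i mod r'))" for i
  note idx = less_mult_imp_div_less mod_less_of_less_mult
  have Xc: "X i \<in> carrier_mat (n * n') (m * m')" if "i < r * r'" for i
    unfolding X_def using E(1) F(1) idx[OF that] by auto
  have iso: "mat_adjoint (X i) * X i = 1\<^sub>m (m * m')" if "i < r * r'" for i
  proof -
    note [simp] = idx[OF that]
    have "mat_adjoint (X i) * X i =
        kronecker (mat_adjoint (E (i div r')) * E (i div r')) (mat_adjoint (F (i mod r')) * F (i mod r'))"
      unfolding X_def mat_adjoint_kronecker using E(1) F(1)
      by (intro kronecker_mult[of _ m n _ m _ m' n' _ m']) auto
    then show ?thesis by (simp add: E(2) F(2) kronecker_one)
  qed
  have gen: "mat_adjoint (X i) * kronecker P Q * X j =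
      kronecker (mat_adjoint (E (i div r')) * P * E (j div r')) (mat_adjoint (F (i mod r')) * Q * F (j mod r'))"
    if "i < r * r'" "j < r * r'" "P \<in> G" "Q \<in> G'" for i j P Q
  proof -
    have "P \<in> carrier_mat n n" "Q \<in> carrier_mat n' n'" using that G op_spaceD(1) by blast+
    then show ?thesis
      unfolding X_def mat_adjoint_kronecker using E(1) F(1) idx[OF that(1)] idx[OF that(2)]
      by (intro kronecker_conj[of _ m n _ n _ m _ m' n' _ n' _ m']) auto
  qed
  have comp: "mat_adjoint (X i) * Y * X j \<in> N"
    if ij: "i < r * r'" "j < r * r'" and Y: "Y \<in> nc_tensor n G n' G'"
      and N: "submodule class_ring N (operators (m * m'))"
      and "\<And>P Q. P \<in> G \<Longrightarrow> Q \<in> G' \<Longrightarrow> mat_adjoint (X i) * kronecker P Q * X j \<in> N" for i j Y N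
    using Xc ij by (intro nc_tensor_conj_subset[OF G _ N that(5) _ Y]) auto
  have same: "mat_adjoint (X i) * Y * X i \<in> nc_tensor m H m' H'"
    if i: "i < r * r'" and Y: "Y \<in> nc_tensor n G n' G'" for i Y
  proof (rule comp[OF i i Y])
    show "submodule class_ring (nc_tensor m H m' H') (operators (m * m'))"
      using H by (intro nc_tensor_submodule op_spaceD)
    show "mat_adjoint (X i) * kronecker P Q * X i \<in> nc_tensor m H m' H'"
      if "P \<in> G" "Q \<in> G'" for P Q
      unfolding gen[OF i i that] using E(3) F(3) idx[OF i] that H
      by (intro kronecker_in_nc_tensor op_spaceD(1))
  qed
  have diff: "mat_adjoint (X i) * Y * X j = 0\<^sub>m (m * m') (m * m')"
    if ij: "i < r * r'" "j < r * r'" "i \<noteq> j" and Y: "Y \<in> nc_tensor n G n' G'" for i j Y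
  proof -
    \<comment> \<open>The zero space is itself a submodule, so vanishing on Kronecker products
      extends to their span by the same \<open>comp\<close> as membership.\<close>
    have "mat_adjoint (X i) * Y * X j \<in> {0\<^sub>m (m * m') (m * m')}"
    proof (rule comp[OF ij(1,2) Y])
      show "submodule class_ring {0\<^sub>m (m * m') (m * m') :: complex mat} (operators (m * m'))"
        by (rule submodule_operatorsI) auto
      fix P Q assume PQ: "P \<in> G" "Q \<in> G'"
      then have c: "P \<in> carrier_mat n n" "Q \<in> carrier_mat n' n'" using G op_spaceD(1) by blast+
      note i = idx[OF ij(1)] idx[OF ij(2)]
      have c1: "mat_adjoint (E (i div r')) * P * E (j div r') \<in> carrier_mat m m"
        using E(1) i c by (intro mult_carrier_mat[of _ m n _ m] mult_carrier_mat[of _ m n _ n]) auto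
      have c2: "mat_adjoint (F (i mod r')) * Q * F (j mod r') \<in> carrier_mat m' m'"
        using F(1) i c by (intro mult_carrier_mat[of _ m' n' _ m'] mult_carrier_mat[of _ m' n' _ n']) auto
      have "i div r' \<noteq> j div r' \<or> i mod r' \<noteq> j mod r'"
        using ij(3) by (metis div_mult_mod_eq)
      then have "kronecker (mat_adjoint (E (i div r')) * P * E (j div r'))
          (mat_adjoint (F (i mod r')) * Q * F (j mod r')) = 0\<^sub>m (m * m') (m * m')"
        using E(4)[OF i(1,3) PQ(1)] F(4)[OF i(2,4) PQ(2)]
          kronecker_zero_left[OF c2] kronecker_zero_right[OF c1] by metis
      then show "mat_adjoint (X i) * kronecker P Q * X j \<in> {0\<^sub>m (m * m') (m * m')}"
        using gen[OF ij(1,2) PQ] by simp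
    qed
    then show ?thesis by simp
  qed
  show ?thesis unfolding embeds_def
    by (rule exI[of _ X]) (use Xc iso same diff in auto)
qed

text \<open>Both bounds with one common r, in a form stable under tensor products; the equation
  between the independence numbers is not stable by itself.\<close>

definition reduces ::
    "nat \<Rightarrow> nat \<Rightarrow> complex mat set \<Rightarrow> nat \<Rightarrow> complex mat set \<Rightarrow> bool" where
  "reduces r n G m H \<longleftrightarrow>
     op_space n G \<and> op_space m H \<and> covers r n G m H \<and> embeds r n G m H"

lemma reduces_independence_number:
  "reduces r n G m H \<Longrightarrow> independence_number n G = r * independence_number m H"
  unfolding reduces_def
  by (meson antisym covers_independence_number_le embeds_independence_number_ge)

lemma reduces_refl:
  assumes "op_space n G"
  shows "reduces 1 n G n G"
proof -
  have c: "Y \<in> carrier_mat n n" if "Y \<in> G" for Y using op_spaceD(1)[OF assms] that by blast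
  have 1: "1\<^sub>m n * Y * 1\<^sub>m n \<in> G" if "Y \<in> G" for Y
    using that c[OF that] by simp
  have "covers 1 n G n G" unfolding covers_def
    by (intro allI impI exI[of _ "{1\<^sub>m n}"]) (use 1 in auto)
  moreover have "embeds 1 n G n G" unfolding embeds_def
    by (rule exI[of _ "\<lambda>_. 1\<^sub>m n"]) (use 1 in auto)
  ultimately show ?thesis using assms by (simp add: reduces_def)
qed

lemma reduces_tensor:
  assumes "reduces r n G m H" "reduces r' n' G' m' H'"
  shows "reduces (r * r') (n * n') (nc_tensor n G n' G') (m * m') (nc_tensor m H m' H')"
  using assms covers_tensor embeds_tensor nc_tensor_op_space unfolding reduces_def by simp

lemma reduces_power:
  assumes "reduces r n G m H"
  shows "reduces (r ^ k) (n ^ k) (nc_power n G k) (m ^ k) (nc_power m H k)"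
proof (induction k)
  case 0
  show ?case using reduces_refl[OF op_space_unit_dim] by simp
next
  case (Suc k)
  then show ?case using reduces_tensor[OF Suc assms] by (simp add: mult.commute)
qed

text \<open>A one-dimensional factor contributes only scalars, and the index coding makes this an
  equality rather than an isomorphism. Reducing the first factor of a tensor product to dimension
  one therefore leaves \<open>T\<close> itself.\<close>

lemma nc_tensor_unit_dim_left:
  assumes "op_space n T"
  shows "nc_tensor 1 (carrier_mat 1 1) n T = T"
proof
  note c = order_refl[of "carrier_mat 1 1"] op_spaceD(1)[OF assms]
  show "nc_tensor 1 (carrier_mat 1 1) n T \<subseteq> T"
    using assms op_spaceD(5)[OF assms] 
    by (intro nc_tensor_subset[OF c]) (auto simp: op_space_def kronecker_unit_dim_left)
  show "T \<subseteq> nc_tensor 1 (carrier_mat 1 1) n T"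
  proof
    fix Q assume "Q \<in> T"
    then have "kronecker (1\<^sub>m 1) Q \<in> nc_tensor 1 (carrier_mat 1 1) n T"
      by (intro kronecker_in_nc_tensor[OF c]) auto
    also have "kronecker (1\<^sub>m 1) Q = Q" by (rule eq_matI) auto
    finally show "Q \<in> nc_tensor 1 (carrier_mat 1 1) n T" .
  qed
qed

lemma independence_number_power_unit_dim:
  "independence_number 1 (nc_power 1 (carrier_mat 1 1) k) = 1"
proof -
  have "op_space 1 (nc_power 1 (carrier_mat 1 1) k)"
    using nc_power_op_space[OF op_space_unit_dim, of k] by simp
  from independence_number_le[OF this] independence_number_pos[OF this] show ?thesis by simp
qed

text \<open>The reduction of S \<otimes> T to \<open>T\<close> is made before powers are taken, so
  the k-th power of the product reduces directly to the k-th power of \<open>T\<close>. No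
  reordering of tensor factors is involved.\<close>

lemma
  assumes "reduces r n S 1 (carrier_mat 1 1)"
  shows independence_number_power:
      "independence_number (n ^ k) (nc_power n S k) = r ^ k"
    and independence_number_tensor_power: "op_space m T \<Longrightarrow>
      independence_number ((n * m) ^ k) (nc_power (n * m) (nc_tensor n S m T) k) =
      r ^ k * independence_number (m ^ k) (nc_power m T k)"
proof -
  show "independence_number (n ^ k) (nc_power n S k) = r ^ k"
    using reduces_independence_number[OF reduces_power[OF assms, of k]]
    by (simp add: independence_number_power_unit_dim[unfolded One_nat_def])
  assume T: "op_space m T"
  have "reduces r (n * m) (nc_tensor n S m T) m T"
    using reduces_tensor[OF assms reduces_refl[OF T]] nc_tensor_unit_dim_left[OF T] by simp
  from reduces_independence_number[OF reduces_power[OF this, of k]]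
  show "independence_number ((n * m) ^ k) (nc_power (n * m) (nc_tensor n S m T) k) =
      r ^ k * independence_number (m ^ k) (nc_power m T k)" .
qed

section \<open>Two-dimensional noncommutative graphs\<close>

lemma mult_conj_assoc:
  fixes U V Y V' U' :: "complex mat"
  assumes "U \<in> carrier_mat a b" "V \<in> carrier_mat b c" "Y \<in> carrier_mat c d"
    "V' \<in> carrier_mat d e" "U' \<in> carrier_mat e f"
  shows "(U * V) * Y * (V' * U') = U * (V * Y * V') * U'"
proof -
  have "(U * V) * Y * (V' * U') = ((U * V) * Y * V') * U'"
    using assms by (intro assoc_mult_mat[symmetric, of _ a d _ e _ f]) auto
  moreover have "(U * V) * Y = U * (V * Y)" using assms by (intro assoc_mult_mat)
  moreover have "U * (V * Y) * V' = U * (V * Y * V')"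
    using assms by (intro assoc_mult_mat[of _ a b _ d _ e]) auto
  ultimately show ?thesis by metis
qed

text \<open>For unitary \<open>U\<close> this is \<open>S\<close> conjugated by the adjoint of
  \<open>U\<close>. Written as a preimage, membership is a direct check in \<open>S\<close>.\<close>

definition conj_graph :: "nat \<Rightarrow> complex mat \<Rightarrow> complex mat set \<Rightarrow> complex mat set" where
  "conj_graph n U S = {Y \<in> carrier_mat n n. U * Y * mat_adjoint U \<in> S}"

lemma conj_graph_op_space:
  assumes U: "U \<in> carrier_mat n n" "U * mat_adjoint U = 1\<^sub>m n" and S: "op_space n S"
  shows "op_space n (conj_graph n U S)"
proof (rule op_spaceI)
  have U': "mat_adjoint U \<in> carrier_mat n n" using U by simp
  show "1\<^sub>m n \<in> conj_graph n U S" using U op_spaceD(2)[OF S] by (simp add: conj_graph_def)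
  show "A + B \<in> conj_graph n U S" if "A \<in> conj_graph n U S" "B \<in> conj_graph n U S" for A B
  proof -
    have c: "A \<in> carrier_mat n n" "B \<in> carrier_mat n n" using that by (auto simp: conj_graph_def)
    have "U * (A + B) * mat_adjoint U = U * A * mat_adjoint U + U * B * mat_adjoint U"
      using c U U' by (simp add: mult_add_distrib_mat[of _ n n _ n] add_mult_distrib_mat[of _ n n _ _ n])
    then show ?thesis using that op_spaceD(4)[OF S] c by (simp add: conj_graph_def)
  qed
  show "c \<cdot>\<^sub>m A \<in> conj_graph n U S" if "A \<in> conj_graph n U S" for c A
  proof -
    have A: "A \<in> carrier_mat n n" using that by (auto simp: conj_graph_def)
    have "U * (c \<cdot>\<^sub>m A) * mat_adjoint U = c \<cdot>\<^sub>m (U * A * mat_adjoint U)"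
      using A U U' by (simp add: mult_smult_distrib[of _ n n _ n] mult_smult_assoc_mat[of _ n n _ n])
    then show ?thesis using that op_spaceD(5)[OF S] A by (simp add: conj_graph_def)
  qed
qed (auto simp: conj_graph_def)

text \<open>Left multiplication by \<open>U\<close> turns the compressions and isometries for the
  conjugated space into ones for \<open>S\<close>.\<close>

lemma reduces_unitary_conj:
  assumes U: "U \<in> carrier_mat n n" "U * mat_adjoint U = 1\<^sub>m n" "mat_adjoint U * U = 1\<^sub>m n"
    and S: "op_space n S" and red: "reduces r n (conj_graph n U S) m H"
  shows "reduces r n S m H"
proof -
  have U': "mat_adjoint U \<in> carrier_mat n n" using U by simp
  have H: "Y \<in> carrier_mat m m" if "Y \<in> H" for Y
    using red op_spaceD(1) that unfolding reduces_def by blast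
  have Sc: "Y \<in> carrier_mat n n" if "Y \<in> S" for Y using op_spaceD(1)[OF S] that by blast
  have cov: "covers r n S m H"
    unfolding covers_def
  proof (intro allI impI)
    fix \<Psi> :: "complex vec set"
    assume \<Psi>: "finite \<Psi>" "\<Psi> \<subseteq> carrier_vec n - {0\<^sub>v n}"
    have "mat_adjoint U *\<^sub>v \<psi> \<in> carrier_vec n - {0\<^sub>v n}" if "\<psi> \<in> \<Psi>" for \<psi>
    proof -
      have c: "\<psi> \<in> carrier_vec n" "\<psi> \<noteq> 0\<^sub>v n" using \<Psi> that by auto
      have "U *\<^sub>v (mat_adjoint U *\<^sub>v \<psi>) = (U * mat_adjoint U) *\<^sub>v \<psi>"
        using U U' c by (intro assoc_mult_mat_vec[symmetric])
      also have "\<dots> = \<psi>" using U c by simp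
      finally have "U *\<^sub>v (mat_adjoint U *\<^sub>v \<psi>) \<noteq> 0\<^sub>v n" using c by simp
      moreover have "U *\<^sub>v 0\<^sub>v n = 0\<^sub>v n" using U(1) by (intro eq_vecI) (auto simp: scalar_prod_def)
      ultimately show ?thesis using c U' by (auto intro!: mult_mat_vec_carrier)
    qed
    then have "finite ((\<lambda>\<psi>. mat_adjoint U *\<^sub>v \<psi>) ` \<Psi>)"
      "(\<lambda>\<psi>. mat_adjoint U *\<^sub>v \<psi>) ` \<Psi> \<subseteq> carrier_vec n - {0\<^sub>v n}" using \<Psi> by auto
    then obtain \<V> where \<V>: "finite \<V>" "card \<V> \<le> r" "\<V> \<subseteq> carrier_mat n m"
      "\<And>V Y. V \<in> \<V> \<Longrightarrow> Y \<in> H \<Longrightarrow> V * Y * mat_adjoint V \<in> conj_graph n U S"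
      "\<And>\<psi>. \<psi> \<in> \<Psi> \<Longrightarrow> \<exists>V\<in>\<V>. mat_adjoint V *\<^sub>v (mat_adjoint U *\<^sub>v \<psi>) \<noteq> 0\<^sub>v m"
      using red unfolding reduces_def covers_def by (metis (no_types, lifting) imageI)
    have adj: "mat_adjoint (U * V) = mat_adjoint V * mat_adjoint U" if "V \<in> \<V>" for V
      using that \<V>(3) U by (intro mat_adjoint_mult) auto
    show "\<exists>\<V>. finite \<V> \<and> card \<V> \<le> r \<and> \<V> \<subseteq> carrier_mat n m \<and>
      (\<forall>V\<in>\<V>. \<forall>Y\<in>H. V * Y * mat_adjoint V \<in> S) \<and>
      (\<forall>\<psi>\<in>\<Psi>. \<exists>V\<in>\<V>. mat_adjoint V *\<^sub>v \<psi> \<noteq> 0\<^sub>v m)"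
    proof (intro exI conjI ballI)
      show "finite ((\<lambda>V. U * V) ` \<V>)" using \<V> by simp
      show "card ((\<lambda>V. U * V) ` \<V>) \<le> r" using \<V> card_image_le order_trans by blast
      show "(\<lambda>V. U * V) ` \<V> \<subseteq> carrier_mat n m" using \<V>(3) U by auto
      show "X * Y * mat_adjoint X \<in> S" if X: "X \<in> (\<lambda>V. U * V) ` \<V>" and Y: "Y \<in> H" for X Y
      proof -
        obtain V where V: "V \<in> \<V>" "X = U * V" using X by blast
        have Vc: "V \<in> carrier_mat n m" using V \<V> by auto
        have "X * Y * mat_adjoint X = U * (V * Y * mat_adjoint V) * mat_adjoint U"
          unfolding V(2) adj[OF V(1)]
          using U U' Vc H[OF Y] by (intro mult_conj_assoc[of _ n n _ m _ m _ n _ n]) auto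
        then show ?thesis using \<V>(4)[OF V(1) Y] by (simp add: conj_graph_def)
      qed
      show "\<exists>X\<in>(\<lambda>V. U * V) ` \<V>. mat_adjoint X *\<^sub>v \<psi> \<noteq> 0\<^sub>v m" if \<psi>: "\<psi> \<in> \<Psi>" for \<psi>
      proof -
        obtain V where V: "V \<in> \<V>" "mat_adjoint V *\<^sub>v (mat_adjoint U *\<^sub>v \<psi>) \<noteq> 0\<^sub>v m"
          using \<V>(5)[OF \<psi>] by blast
        have Vc: "V \<in> carrier_mat n m" and c: "\<psi> \<in> carrier_vec n" using V \<V> \<psi> \<Psi> by auto
        have "(mat_adjoint V * mat_adjoint U) *\<^sub>v \<psi> = mat_adjoint V *\<^sub>v (mat_adjoint U *\<^sub>v \<psi>)"
          using Vc U' c by (intro assoc_mult_mat_vec[of _ m n _ n]) auto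
        then show ?thesis using V adj[OF V(1)] by (intro bexI[of _ "U * V"]) auto
      qed
    qed
  qed
  obtain E where E: "\<And>i. i < r \<Longrightarrow> E i \<in> carrier_mat n m"
    "\<And>i. i < r \<Longrightarrow> mat_adjoint (E i) * E i = 1\<^sub>m m"
    "\<And>i Y. i < r \<Longrightarrow> Y \<in> conj_graph n U S \<Longrightarrow> mat_adjoint (E i) * Y * E i \<in> H"
    "\<And>i j Y. i < r \<Longrightarrow> j < r \<Longrightarrow> Y \<in> conj_graph n U S \<Longrightarrow> i \<noteq> j \<Longrightarrow> mat_adjoint (E i) * Y * E j = 0\<^sub>m m m"
    using red unfolding reduces_def embeds_def by metis
  have adj: "mat_adjoint (U * E i) = mat_adjoint (E i) * mat_adjoint U" if "i < r" for i
    using E(1)[OF that] U by (intro mat_adjoint_mult)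
  have move: "mat_adjoint (U * E i) * Y * (U * E j) = mat_adjoint (E i) * (mat_adjoint U * Y * U) * E j"
    if "i < r" "j < r" "Y \<in> S" for i j Y
    unfolding adj[OF that(1)]
    using U U' E(1) Sc that by (intro mult_conj_assoc[of _ m n _ n _ n _ n _ m]) auto
  have in_conj: "mat_adjoint U * Y * U \<in> conj_graph n U S" if "Y \<in> S" for Y
  proof -
    have "U * (mat_adjoint U * Y * U) * mat_adjoint U = (U * mat_adjoint U) * Y * (U * mat_adjoint U)"
      using U U' Sc[OF that] by (intro mult_conj_assoc[symmetric, of _ n n _ n _ n _ n _ n])
    also have "\<dots> = Y" using U Sc[OF that] by simp
    finally show ?thesis using U U' Sc[OF that] that by (auto simp: conj_graph_def simp del: assoc_mult_mat)
  qed
  have "mat_adjoint (U * E i) * (U * E i) = 1\<^sub>m m" if "i < r" for i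
  proof -
    \<comment> \<open>The inserted identity lies in \<open>S\<close>, which makes the isometry
      condition an instance of \<open>move\<close>.\<close>
    have "mat_adjoint (U * E i) * (U * E i) = mat_adjoint (U * E i) * 1\<^sub>m n * (U * E i)"
      using U E(1)[OF that] by (subst right_mult_one_mat[of _ m n]) auto
    also have "\<dots> = mat_adjoint (E i) * (mat_adjoint U * 1\<^sub>m n * U) * E i"
      by (rule move[OF that that op_spaceD(2)[OF S]])
    also have "\<dots> = 1\<^sub>m m" using U U' E(1,2)[OF that] by (simp add: right_mult_one_mat[of _ m n])
    finally show ?thesis .
  qed
  then have "embeds r n S m H"
    unfolding embeds_def using U E move in_conj
    by (intro exI[of _ "\<lambda>i. U * E i"]) auto
  with cov S red show ?thesis by (simp add: reduces_def)
qed

section \<open>Explicit matrices and column vectors in dimension two\<close>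

definition mat2 :: "complex \<Rightarrow> complex \<Rightarrow> complex \<Rightarrow> complex \<Rightarrow> complex mat" where
  "mat2 a b c d = mat 2 2 (\<lambda>(i, j). if i = 0 then (if j = 0 then a else b) else (if j = 0 then c else d))"

text \<open>A vector of the qubit space as a one-column matrix, so that it can serve as a
  compression or an isometry to dimension one.\<close>

definition ket2 :: "complex \<Rightarrow> complex \<Rightarrow> complex mat" where
  "ket2 a b = mat 2 1 (\<lambda>(i, j). if i = 0 then a else b)"

lemma less_two_iff: "i < (2 :: nat) \<longleftrightarrow> i = 0 \<or> i = 1" by auto

lemma sum_lessThan_2: "sum f {0..<2} = f 0 + (f (Suc 0) :: 'a :: comm_monoid_add)"
  by (simp add: numeral_2_eq_2)

lemma mat2_simps [simp]:
  "mat2 a b c d \<in> carrier_mat 2 2" "dim_row (mat2 a b c d) = 2" "dim_col (mat2 a b c d) = 2"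
  "mat2 a b c d $$ (0, 0) = a" "mat2 a b c d $$ (0, Suc 0) = b"
  "mat2 a b c d $$ (Suc 0, 0) = c" "mat2 a b c d $$ (Suc 0, Suc 0) = d"
  by (auto simp: mat2_def)

lemma mat2_eta: "A \<in> carrier_mat 2 2 \<Longrightarrow> A = mat2 (A $$ (0, 0)) (A $$ (0, 1)) (A $$ (1, 0)) (A $$ (1, 1))"
  by (rule eq_matI) (auto simp: less_two_iff)

lemma mat2_eq_iff: "mat2 a b c d = mat2 a' b' c' d' \<longleftrightarrow> a = a' \<and> b = b' \<and> c = c' \<and> d = d'"
  by (metis mat2_simps(4-7))

lemma mat2_add: "mat2 a b c d + mat2 a' b' c' d' = mat2 (a + a') (b + b') (c + c') (d + d')"
  by (rule eq_matI) (auto simp: less_two_iff)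

lemma mat2_smult: "x \<cdot>\<^sub>m mat2 a b c d = mat2 (x * a) (x * b) (x * c) (x * d)"
  by (rule eq_matI) (auto simp: less_two_iff)

lemma mat2_mult: "mat2 a b c d * mat2 a' b' c' d' =
    mat2 (a * a' + b * c') (a * b' + b * d') (c * a' + d * c') (c * b' + d * d')"
  by (rule eq_matI) (auto simp: less_two_iff scalar_prod_def sum_lessThan_2)

lemma mat2_adjoint: "mat_adjoint (mat2 a b c d) = mat2 (cnj a) (cnj c) (cnj b) (cnj d)"
  by (rule eq_matI) (auto simp: less_two_iff)

lemma mat2_one: "1\<^sub>m 2 = mat2 1 0 0 1"
  by (rule eq_matI) (auto simp: less_two_iff)

lemma ket2_simps [simp]:
  "ket2 a b \<in> carrier_mat 2 1" "dim_row (ket2 a b) = 2" "dim_col (ket2 a b) = 1"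
  "ket2 a b $$ (0, 0) = a" "ket2 a b $$ (Suc 0, 0) = b"
  by (auto simp: ket2_def)

lemma ket2_outer:
  assumes "Y \<in> carrier_mat 1 1"
  shows "ket2 a b * Y * mat_adjoint (ket2 a b) =
    Y $$ (0, 0) \<cdot>\<^sub>m mat2 (a * cnj a) (a * cnj b) (b * cnj a) (b * cnj b)"
  by (rule eq_matI) (use assms in \<open>auto simp: less_two_iff scalar_prod_def mult_ac\<close>)

lemma ket2_inner: "mat_adjoint (ket2 a b) * ket2 c d = (cnj a * c + cnj b * d) \<cdot>\<^sub>m 1\<^sub>m 1"
  by (rule eq_matI) (auto simp: scalar_prod_def sum_lessThan_2)

lemma ket2_apply_eq_0_iff:
  "v \<in> carrier_vec 2 \<Longrightarrow> mat_adjoint (ket2 a b) *\<^sub>v v = 0\<^sub>v 1 \<longleftrightarrow> cnj a * v $ 0 + cnj b * v $ 1 = 0"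
  by (subst vec_eq_iff) (auto simp: scalar_prod_def sum_lessThan_2)

lemma ket2_sandwich:
  "A \<in> carrier_mat 2 2 \<Longrightarrow> mat_adjoint (ket2 a b) * A * ket2 c d =
    ((cnj a * A $$ (0, 0) + cnj b * A $$ (1, 0)) * c +
      (cnj a * A $$ (0, 1) + cnj b * A $$ (1, 1)) * d) \<cdot>\<^sub>m 1\<^sub>m 1"
  by (rule eq_matI) (auto simp: scalar_prod_def sum_lessThan_2)

lemma vec2_nonzero: "v \<in> carrier_vec 2 - {0\<^sub>v 2} \<Longrightarrow> v $ 0 \<noteq> 0 \<or> v $ 1 \<noteq> (0 :: complex)"
  using vec_nonzero_index[of v 2] by (auto simp: less_two_iff)

text \<open>The two basis kets serve both as cover and as isometries: their outer products are the
  diagonal matrix units, and the mixed blocks of \<open>Y\<close> are its off-diagonal entries. A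
  nonzero vector has a nonzero coordinate, so one of them keeps it.\<close>

lemma reduces_diagonal:
  assumes S: "op_space 2 S" and "mat2 1 0 0 0 \<in> S" "mat2 0 0 0 1 \<in> S"
    and off: "\<And>Y. Y \<in> S \<Longrightarrow> Y $$ (0, 1) = 0 \<and> Y $$ (1, 0) = 0"
  shows "reduces 2 2 S 1 (carrier_mat 1 1)"
proof -
  have c: "Y \<in> carrier_mat 2 2" if "Y \<in> S" for Y using op_spaceD(1)[OF S] that by blast
  have "covers 2 2 S 1 (carrier_mat 1 1)"
    unfolding covers_def
  proof (intro allI impI exI[of _ "{ket2 1 0, ket2 0 1}"] conjI ballI)
    fix \<Psi> :: "complex vec set" and \<psi>
    assume "\<Psi> \<subseteq> carrier_vec 2 - {0\<^sub>v 2}" "\<psi> \<in> \<Psi>"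
    then have "\<psi> \<in> carrier_vec 2 - {0\<^sub>v 2}" by blast
    with vec2_nonzero[OF this]
    show "\<exists>V\<in>{ket2 1 0, ket2 0 1}. mat_adjoint V *\<^sub>v \<psi> \<noteq> 0\<^sub>v 1"
      by (auto simp: ket2_apply_eq_0_iff[unfolded One_nat_def])
  next
    fix V Y :: "complex mat"
    assume "V \<in> {ket2 1 0, ket2 0 1}" "Y \<in> carrier_mat 1 1"
    then show "V * Y * mat_adjoint V \<in> S"
      using assms(2,3) op_spaceD(5)[OF S] by (auto simp: ket2_outer[unfolded One_nat_def])
  qed (auto simp: card_insert_if)
  moreover have "embeds 2 2 S 1 (carrier_mat 1 1)"
    unfolding embeds_def
    by (rule exI[of _ "\<lambda>i. if i = 0 then ket2 1 0 else ket2 0 1"])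
       (use off c in \<open>auto simp: less_two_iff ket2_inner[unfolded One_nat_def] ket2_sandwich[unfolded One_nat_def]\<close>)
  ultimately show ?thesis using S op_space_unit_dim by (simp add: reduces_def)
qed

lemma reduces_offdiagonal:
  assumes S: "op_space 2 S" and D: "mat2 1 0 0 0 \<in> S" "mat2 0 0 0 1 \<in> S"
    and w: "mat2 0 w (cnj w) 0 \<in> S" "w \<noteq> 0"
  shows "reduces 1 2 S 1 (carrier_mat 1 1)"
proof -
  have c: "Y \<in> carrier_mat 2 2" if "Y \<in> S" for Y using op_spaceD(1)[OF S] that by blast
  have "covers 1 2 S 1 (carrier_mat 1 1)"
    unfolding covers_def
  proof (intro allI impI)
    fix \<Psi> :: "complex vec set"
    assume \<Psi>: "finite \<Psi>" "\<Psi> \<subseteq> carrier_vec 2 - {0\<^sub>v 2}"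
    \<comment> \<open>\<open>V * V\<^sup>*\<close> lies in \<open>S\<close> for every real \<open>s\<close>, and each nonzero vector is orthogonal to \<open>V\<close> for at
      most one \<open>s\<close>.\<close>
    obtain s :: real where s: "s \<notin> (\<lambda>\<psi>. Re (- \<psi> $ 1 / (cnj w * \<psi> $ 0))) ` \<Psi>"
      using ex_new_if_finite[OF infinite_UNIV_char_0] \<Psi>(1) by blast
    define V where "V = ket2 (of_real s * w) 1"
    have "mat_adjoint V *\<^sub>v \<psi> \<noteq> 0\<^sub>v 1" if "\<psi> \<in> \<Psi>" for \<psi>
    proof
      have \<psi>: "\<psi> \<in> carrier_vec 2 - {0\<^sub>v 2}" using \<Psi> that by blast
      assume "mat_adjoint V *\<^sub>v \<psi> = 0\<^sub>v 1"
      then have eq: "of_real s * (cnj w * \<psi> $ 0) + \<psi> $ 1 = 0"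
        using \<psi> unfolding V_def by (subst (asm) ket2_apply_eq_0_iff) (auto simp: mult_ac)
      \<comment> \<open>With \<open>\<psi> $ 0 = 0\<close> the equation would force
        \<open>\<psi> $ 1 = 0\<close> too. For such vectors the excluded quotient is a division by
        zero, which merely rules out \<open>s = 0\<close>.\<close>
      then have "\<psi> $ 0 \<noteq> 0" using vec2_nonzero[OF \<psi>] by auto
      then have "of_real s = - \<psi> $ 1 / (cnj w * \<psi> $ 0)"
        using eq w(2) by (simp add: field_simps add_eq_0_iff2)
      then have "s = Re (- \<psi> $ 1 / (cnj w * \<psi> $ 0))" by (metis Re_complex_of_real)
      with s that show False by blast
    qed
    moreover have "V * Y * mat_adjoint V \<in> S" if "Y \<in> carrier_mat 1 1" for Y
    proof -
      \<comment> \<open>This is the outer product of \<open>V\<close> with itself. A real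
        \<open>s\<close> is essential: it makes the off-diagonal entries a common multiple of
        \<open>w\<close> and \<open>cnj w\<close>.\<close>
      have "(of_real s * w * cnj (of_real s * w)) \<cdot>\<^sub>m mat2 1 0 0 0
          + of_real s \<cdot>\<^sub>m mat2 0 w (cnj w) 0 + mat2 0 0 0 1 \<in> S"
        by (intro op_spaceD(4)[OF S] op_spaceD(5)[OF S] D w)
      from op_spaceD(5)[OF S this, of "Y $$ (0, 0)"] show ?thesis
        using that unfolding V_def ket2_outer[OF that]
        by (simp add: mat2_add mat2_smult mult_ac)
    qed
    ultimately show "\<exists>\<V>. finite \<V> \<and> card \<V> \<le> 1 \<and> \<V> \<subseteq> carrier_mat 2 1 \<and>
        (\<forall>V\<in>\<V>. \<forall>Y\<in>carrier_mat 1 1. V * Y * mat_adjoint V \<in> S) \<and>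
        (\<forall>\<psi>\<in>\<Psi>. \<exists>V\<in>\<V>. mat_adjoint V *\<^sub>v \<psi> \<noteq> 0\<^sub>v 1)"
      by (intro exI[of _ "{V}"]) (auto simp: V_def)
  qed
  moreover have "embeds 1 2 S 1 (carrier_mat 1 1)"
    unfolding embeds_def
    \<comment> \<open>With one isometry there are no mixed blocks, and the target is all of the 1 by
      1 matrices, so any unit vector would do.\<close>
    by (rule exI[of _ "\<lambda>_. ket2 1 0"])
       (use c in \<open>auto simp: ket2_inner[unfolded One_nat_def] ket2_sandwich[unfolded One_nat_def]\<close>)
  ultimately show ?thesis using S op_space_unit_dim by (simp add: reduces_def)
qed

lemma reduces_of_diagonal_element:
  assumes S: "op_space 2 S" and adj: "\<And>A. A \<in> S \<Longrightarrow> mat_adjoint A \<in> S"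
    and D: "mat2 x 0 0 y \<in> S" "x \<noteq> y"
  shows "\<exists>r\<in>{1, 2}. reduces r 2 S 1 (carrier_mat 1 1)"
proof -
  note comb = op_spaceD(4)[OF S] op_spaceD(5)[OF S]
  have one: "mat2 1 0 0 1 \<in> S" using op_spaceD(2)[OF S] by (simp add: mat2_one)
  \<comment> \<open>Interpolation at the two distinct eigenvalues yields the projection onto the
    first.\<close>
  have "(1 / (x - y)) \<cdot>\<^sub>m (mat2 x 0 0 y + (- y) \<cdot>\<^sub>m mat2 1 0 0 1) \<in> S"
    by (intro comb D one)
  then have E0: "mat2 1 0 0 0 \<in> S" using D(2) by (simp add: mat2_add mat2_smult)
  have "mat2 1 0 0 1 + (- 1) \<cdot>\<^sub>m mat2 1 0 0 0 \<in> S" by (intro comb one E0)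
  then have E1: "mat2 0 0 0 1 \<in> S" by (simp add: mat2_add mat2_smult)
  show ?thesis
  proof (cases "\<forall>Y\<in>S. Y $$ (0, 1) = 0 \<and> Y $$ (1, 0) = 0")
    case True
    then show ?thesis using reduces_diagonal[OF S E0 E1] by blast
  next
    case False
    then obtain Y where Y: "Y \<in> S" "\<not> (Y $$ (0, 1) = 0 \<and> Y $$ (1, 0) = 0)" by blast
    obtain a b c d where abcd: "Y = mat2 a b c d"
      using mat2_eta[of Y] op_spaceD(1)[OF S] Y(1) by blast
    have Y': "mat2 (cnj a) (cnj c) (cnj b) (cnj d) \<in> S"
      using adj[OF Y(1)] by (simp add: abcd mat2_adjoint)
    have "\<exists>w. w \<noteq> 0 \<and> mat2 0 w (cnj w) 0 \<in> S"
    \<comment> \<open>\<open>Y\<close> plus its adjoint has off-diagonal entry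
      \<open>b + cnj c\<close>; \<open>\<i>\<close> times their difference has
      \<open>\<i> * (b - cnj c)\<close>. Both vanish only if \<open>b = c = 0\<close>. The diagonals
      are cleared with the two matrix units.\<close>
    proof (cases "b + cnj c = 0")
      case True
      have "\<i> \<cdot>\<^sub>m (mat2 a b c d + (- 1) \<cdot>\<^sub>m mat2 (cnj a) (cnj c) (cnj b) (cnj d)
          + (cnj a - a) \<cdot>\<^sub>m mat2 1 0 0 0 + (cnj d - d) \<cdot>\<^sub>m mat2 0 0 0 1) \<in> S"
        using Y(1) Y' unfolding abcd by (intro comb E0 E1)
      then have "mat2 0 (\<i> * (b - cnj c)) (cnj (\<i> * (b - cnj c))) 0 \<in> S"
        by (simp add: mat2_add mat2_smult algebra_simps)
      moreover have "b \<noteq> cnj c" using True Y(2) by (auto simp: abcd)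
      ultimately show ?thesis by (intro exI[of _ "\<i> * (b - cnj c)"]) simp
    next
      case False
      have "mat2 a b c d + mat2 (cnj a) (cnj c) (cnj b) (cnj d)
          + (- a - cnj a) \<cdot>\<^sub>m mat2 1 0 0 0 + (- d - cnj d) \<cdot>\<^sub>m mat2 0 0 0 1 \<in> S"
        using Y(1) Y' unfolding abcd by (intro comb E0 E1)
      then have "mat2 0 (b + cnj c) (cnj (b + cnj c)) 0 \<in> S"
        by (simp add: mat2_add mat2_smult algebra_simps)
      with False show ?thesis by blast
    qed
    then show ?thesis using reduces_offdiagonal[OF S E0 E1] by blast
  qed
qed

text \<open>The columns of \<open>U\<close> are the eigenvectors (z, t) and (-t, cnj z), scaled by
  \<open>k\<close>, for the eigenvalues p + t and q - t. All verifications rest on two identities: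
  the normalisation \<open>K\<close> and the characteristic equation \<open>z\<close>.\<close>

lemma hermitian_mat2_diagonalization:
  fixes p q :: real and z :: complex
  assumes ne: "z \<noteq> 0 \<or> p \<noteq> q"
  obtains U x y where "U \<in> carrier_mat 2 2" "U * mat_adjoint U = 1\<^sub>m 2" "mat_adjoint U * U = 1\<^sub>m 2"
    "U * mat2 x 0 0 y * mat_adjoint U = mat2 p z (cnj z) q" "x \<noteq> y"
proof (cases "z = 0")
  case True
  show ?thesis
    by (rule that[of "mat2 1 0 0 1" p q])
       (use True ne in \<open>auto simp: mat2_mult mat2_adjoint mat2_one\<close>)
next
  case False
  \<comment> \<open>\<open>p + t\<close> is the larger eigenvalue, \<open>\<delta>\<close> the gap between the two, and \<open>(z, t)\<close> an eigenvector
    of squared norm \<open>t * \<delta>\<close>.\<close>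
  define \<delta> where "\<delta> = sqrt ((p - q)\<^sup>2 + 4 * (cmod z)\<^sup>2)"
  define t where "t = (q - p + \<delta>) / 2"
  have \<delta>: "\<delta>\<^sup>2 = (p - q)\<^sup>2 + 4 * (cmod z)\<^sup>2" by (simp add: \<delta>_def)
  \<comment> \<open>Strictness comes from \<open>z \<noteq> 0\<close> and gives
    \<open>t > 0\<close>, so that the normalising factor exists.\<close>
  have "\<delta> > \<bar>p - q\<bar>"
    unfolding \<delta>_def using False by (intro real_less_rsqrt) simp
  then have pos: "t > 0" "\<delta> > 0" by (auto simp: t_def)
  define k where "k = 1 / sqrt (t * \<delta>)"
  have "k * k * (t * \<delta>) = 1" using pos by (simp add: k_def)
  then have "complex_of_real (k * k * (t * \<delta>)) = 1" by simp
  moreover have "\<delta> = 2 * t + p - q" unfolding t_def by argo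
  ultimately have K: "complex_of_real k * of_real k * (of_real t * (2 * of_real t + of_real p - of_real q)) = 1"
    by simp
  \<comment> \<open>The characteristic equation at the eigenvalue p + t.\<close>
  have "(cmod z)\<^sup>2 = t * (t + p - q)"
    using \<delta> by (simp add: t_def power2_eq_square field_simps)
  then have z: "z * cnj z = of_real t * (of_real t + of_real p - of_real q)"
    by (simp flip: complex_norm_square)
  \<comment> \<open>Embedded reals and conjugates become atoms, with \<open>w\<close> for
    \<open>cnj z\<close>; what remains is polynomial algebra modulo the two identities.\<close>
  define K T P Q where "K = complex_of_real k" and "T = complex_of_real t"
    and "P = complex_of_real p" and "Q = complex_of_real q"
  obtain w where w: "cnj z = w" by blast
  note K = K[folded K_def T_def P_def Q_def] and z = z[folded K_def T_def P_def Q_def, unfolded w]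
  have real: "cnj K = K" "cnj T = T" by (simp_all add: K_def T_def)
  define U where "U = mat2 (K * z) (- K * T) (K * T) (K * w)"
  have adj: "mat_adjoint U = mat2 (K * w) (K * T) (- K * T) (K * z)"
    by (simp add: U_def mat2_adjoint real flip: w)
  show ?thesis
  proof (rule that[of U "P + T" "Q - T"])
    show "U \<in> carrier_mat 2 2" by (simp add: U_def)
    have e: "K * K * (z * w) = K * K * (T * (T + P - Q))" by (simp add: z)
    have "K * z * (K * w) + K * T * (K * T) = K * K * (z * w) + K * K * (T * T)"
      by (simp add: algebra_simps)
    also have "\<dots> = K * K * (T * (2 * T + P - Q))" unfolding e by (simp add: algebra_simps)
    finally show "U * mat_adjoint U = 1\<^sub>m 2" "mat_adjoint U * U = 1\<^sub>m 2"
      unfolding adj unfolding U_def mat2_mult mat2_one mat2_eq_iff K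
      by (simp_all add: mult_ac add_ac)
    have "K * z * (P + T) * (K * w) + K * T * (Q - T) * (K * T) =
        K * K * (z * w) * (P + T) + K * K * (T * T) * (Q - T)" by (simp add: algebra_simps)
    also have "\<dots> = K * K * (T * (2 * T + P - Q)) * P" unfolding e by (simp add: algebra_simps)
    finally have "K * z * (P + T) * (K * w) + K * T * (Q - T) * (K * T) = P" by (simp add: K)
    moreover have "K * T * (P + T) * (K * T) + K * w * (Q - T) * (K * z) =
        K * K * (z * w) * (Q - T) + K * K * (T * T) * (P + T)" by (simp add: algebra_simps)
    then have "K * T * (P + T) * (K * T) + K * w * (Q - T) * (K * z) =
        K * K * (T * (2 * T + P - Q)) * Q" unfolding e by (simp add: algebra_simps)
    then have "K * T * (P + T) * (K * T) + K * w * (Q - T) * (K * z) = Q" by (simp add: K)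
    moreover have "K * z * (P + T) * (K * T) - K * T * (Q - T) * (K * z) =
        K * K * (T * (2 * T + P - Q)) * z" by (simp add: algebra_simps)
    then have "K * z * (P + T) * (K * T) - K * T * (Q - T) * (K * z) = z" by (simp add: K)
    moreover have "K * T * (P + T) * (K * w) - K * w * (Q - T) * (K * T) =
        K * K * (T * (2 * T + P - Q)) * w" by (simp add: algebra_simps)
    then have "K * T * (P + T) * (K * w) - K * w * (Q - T) * (K * T) = w" by (simp add: K)
    ultimately
    show "U * mat2 (P + T) 0 0 (Q - T) * mat_adjoint U = mat2 p z (cnj z) q"
      unfolding adj w unfolding U_def mat2_mult mat2_eq_iff P_def[symmetric] Q_def[symmetric]
      by simp
    \<comment> \<open>The eigenvalue gap is a factor of the product that equals 1 by
      \<open>K\<close>.\<close>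
    show "P + T \<noteq> Q - T"
    proof
      assume "P + T = Q - T"
      moreover have "2 * T + P - Q = (P + T) - (Q - T)" by simp
      ultimately have "2 * T + P - Q = 0" by simp
      with K show False by simp
    qed
  qed
qed

text \<open>For nonscalar \<open>A\<close> in \<open>S\<close>, the sum of \<open>A\<close> and its
  adjoint and \<open>\<i>\<close> times their difference are Hermitian; were both scalar,
  \<open>A\<close> would be too. The diagonals \<open>2 * Re\<close> and \<open>- 2 * Im\<close> are
  those of these two matrices.\<close>

lemma nonscalar_hermitian_exists:
  assumes S: "op_space 2 S" and adj: "\<And>A. A \<in> S \<Longrightarrow> mat_adjoint A \<in> S"
    and ns: "S \<noteq> {c \<cdot>\<^sub>m 1\<^sub>m 2 | c. True}"
  obtains p q :: real and z where "mat2 p z (cnj z) q \<in> S" "z \<noteq> 0 \<or> p \<noteq> q"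
proof -
  have "{c \<cdot>\<^sub>m 1\<^sub>m 2 | c. True} \<subseteq> S" using op_spaceD(2,5)[OF S] by auto
  with ns obtain A where A: "A \<in> S" "\<nexists>c. A = c \<cdot>\<^sub>m 1\<^sub>m 2" by blast
  obtain a b c d where abcd: "A = mat2 a b c d"
    using mat2_eta[of A] op_spaceD(1)[OF S] A(1) by blast
  have A': "mat2 (cnj a) (cnj c) (cnj b) (cnj d) \<in> S"
    using adj[OF A(1)] by (simp add: abcd mat2_adjoint)
  have "\<not> (b = 0 \<and> c = 0 \<and> a = d)" using A(2) by (auto simp: abcd mat2_one mat2_smult mat2_eq_iff)
  moreover have "b = 0 \<and> c = 0 \<and> a = d" if "b + cnj c = 0" "2 * Re a = 2 * Re d"
    "\<i> * (b - cnj c) = 0" "- 2 * Im a = - 2 * Im d"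
    using that by (auto simp: complex_eq_iff)
  ultimately consider "b + cnj c \<noteq> 0 \<or> 2 * Re a \<noteq> 2 * Re d"
    | "\<i> * (b - cnj c) \<noteq> 0 \<or> - 2 * Im a \<noteq> - 2 * Im d"
    by blast
  then show ?thesis
  proof cases
    case 1
    have "mat2 a b c d + mat2 (cnj a) (cnj c) (cnj b) (cnj d) \<in> S"
      using A(1) A' unfolding abcd by (intro op_spaceD(4)[OF S])
    then have "mat2 (of_real (2 * Re a)) (b + cnj c) (cnj (b + cnj c)) (of_real (2 * Re d)) \<in> S"
      by (simp add: mat2_add complex_add_cnj add.commute)
    with 1 show ?thesis by (rule that[rotated])
  next
    case 2
    have "\<i> \<cdot>\<^sub>m (mat2 a b c d + (- 1) \<cdot>\<^sub>m mat2 (cnj a) (cnj c) (cnj b) (cnj d)) \<in> S"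
      using A(1) A' unfolding abcd by (intro op_spaceD(4,5)[OF S])
    also have "\<i> \<cdot>\<^sub>m (mat2 a b c d + (- 1) \<cdot>\<^sub>m mat2 (cnj a) (cnj c) (cnj b) (cnj d)) =
        mat2 (of_real (- 2 * Im a)) (\<i> * (b - cnj c)) (cnj (\<i> * (b - cnj c))) (of_real (- 2 * Im d))"
      by (simp add: mat2_add mat2_smult mat2_eq_iff complex_eq_iff)
    finally have "mat2 (of_real (- 2 * Im a)) (\<i> * (b - cnj c))
        (cnj (\<i> * (b - cnj c))) (of_real (- 2 * Im d)) \<in> S" .
    with 2 show ?thesis by (rule that[rotated])
  qed
qed

lemma nonscalar_qubit_graph_reduces:
  assumes "nc_graph 2 S" and ns: "S \<noteq> {c \<cdot>\<^sub>m 1\<^sub>m 2 | c. True}"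
  shows "\<exists>r\<in>{1, 2}. reduces r 2 S 1 (carrier_mat 1 1)"
proof -
  have S: "op_space 2 S" by (rule nc_graph_op_space[OF assms(1)])
  have adj: "mat_adjoint A \<in> S" if "A \<in> S" for A
    using assms(1) that unfolding nc_graph_def by blast
  obtain p q :: real and z where H: "mat2 p z (cnj z) q \<in> S" "z \<noteq> 0 \<or> p \<noteq> q"
    by (rule nonscalar_hermitian_exists[OF S adj ns])
  obtain U x y where U: "U \<in> carrier_mat 2 2" "U * mat_adjoint U = 1\<^sub>m 2" "mat_adjoint U * U = 1\<^sub>m 2"
    and D: "U * mat2 x 0 0 y * mat_adjoint U = mat2 p z (cnj z) q" "x \<noteq> y"
    by (rule hermitian_mat2_diagonalization[OF H(2)])
  have U': "mat_adjoint U \<in> carrier_mat 2 2" using U by simp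
  have "mat_adjoint Y \<in> conj_graph 2 U S" if "Y \<in> conj_graph 2 U S" for Y
  proof -
    have Y: "Y \<in> carrier_mat 2 2" "U * Y * mat_adjoint U \<in> S" using that by (auto simp: conj_graph_def)
    have "mat_adjoint (U * Y * mat_adjoint U) = U * (mat_adjoint Y * mat_adjoint U)"
      using U U' Y mat_adjoint_mult[of "U * Y" 2 2 "mat_adjoint U" 2] mat_adjoint_mult[of U 2 2 Y 2] by simp
    also have "\<dots> = U * mat_adjoint Y * mat_adjoint U"
      using U U' Y by (intro assoc_mult_mat[symmetric]) auto
    finally show ?thesis using adj[OF Y(2)] Y(1) by (simp add: conj_graph_def del: assoc_mult_mat)
  qed
  moreover have "mat2 x 0 0 y \<in> conj_graph 2 U S" using D(1) H(1) by (simp add: conj_graph_def)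
  ultimately obtain r where "r \<in> {1, 2}" "reduces r 2 (conj_graph 2 U S) 1 (carrier_mat 1 1)"
    using reduces_of_diagonal_element[OF conj_graph_op_space[OF U(1,2) S]] D(2) by blast
  then show ?thesis using reduces_unitary_conj[OF U S] by blast
qed

section \<open>Capacities\<close>

text \<open>\<open>lim\<close> of every divergent sequence is the same junk value, hence the second alternative; it makes
  a convergence proof for the normalised capacities unnecessary.\<close>
lemma lim_add_const_cases:
  fixes X Y :: "nat \<Rightarrow> real"
  assumes "\<And>k. k > 0 \<Longrightarrow> X k = c + Y k"
  shows "lim X = c + lim Y \<or> lim X = lim Y"
proof (cases "convergent Y")
  case True
  then have "(\<lambda>k. c + Y k) \<longlonglongrightarrow> c + lim Y"
    by (intro tendsto_intros) (simp add: convergent_LIMSEQ_iff)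
  then have "X \<longlonglongrightarrow> c + lim Y"
    by (rule Lim_transform_eventually) (use assms in \<open>auto intro!: eventually_sequentiallyI[of 1]\<close>)
  then show ?thesis by (simp add: limI)
next
  case False
  have "\<not> convergent X"
  proof
    assume "convergent X"
    then obtain L where "X \<longlonglongrightarrow> L" by (auto simp: convergent_def)
    then have "(\<lambda>k. X k - c) \<longlonglongrightarrow> L - c" by (intro tendsto_intros)
    then have "Y \<longlonglongrightarrow> L - c"
      by (rule Lim_transform_eventually) (use assms in \<open>auto intro!: eventually_sequentiallyI[of 1]\<close>)
    with False show False by (auto simp: convergent_def)
  qed
  with False have "X \<longlonglongrightarrow> L \<longleftrightarrow> Y \<longlonglongrightarrow> L" for L by (auto simp: convergent_def)
  then show ?thesis by (simp add: lim_def)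
qed

lemma zero_error_capacity_reduces:
  assumes "reduces r n S 1 (carrier_mat 1 1)" "r > 0"
  shows "zero_error_capacity n S = log 2 r"
proof -
  have "(\<lambda>k. 1 / real k * one_shot_capacity (n ^ k) (nc_power n S k)) \<longlonglongrightarrow> log 2 r"
    using assms(2)
    \<comment> \<open>The sequence is constant from index 1 on; its term at index 0 carries
      \<open>1 / 0 = 0\<close>.\<close>
    by (intro tendsto_eventually eventually_sequentiallyI[of 1])
       (auto simp: one_shot_capacity_def independence_number_power[OF assms(1)] log_nat_power)
  then show ?thesis unfolding zero_error_capacity_def by (rule limI)
qed

lemma zero_error_capacity_tensor_reduces:
  assumes S: "reduces r n S 1 (carrier_mat 1 1)" "r > 0" and T: "op_space m T" "m > 0"
  shows "zero_error_capacity (n * m) (nc_tensor n S m T) = log 2 r + zero_error_capacity m T \<or>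
    zero_error_capacity (n * m) (nc_tensor n S m T) = zero_error_capacity m T"
  unfolding zero_error_capacity_def
proof (rule lim_add_const_cases)
  fix k :: nat assume "k > 0"
  \<comment> \<open>Positivity lets the logarithm of the product split; the factor
    \<open>r ^ k\<close> then contributes \<open>log 2 r\<close> for every
    \<open>k > 0\<close>.\<close>
  have "independence_number (m ^ k) (nc_power m T k) \<ge> 1"
    using independence_number_pos[OF nc_power_op_space[OF T(1)]] T(2) by simp
  then show "1 / real k * one_shot_capacity ((n * m) ^ k) (nc_power (n * m) (nc_tensor n S m T) k) =
      log 2 r + 1 / real k * one_shot_capacity (m ^ k) (nc_power m T k)"
    unfolding one_shot_capacity_def independence_number_tensor_power[OF S(1) T(1)]
    using S(2) \<open>k > 0\<close> by (simp add: log_mult log_nat_power field_simps)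
qed

theorem theorem7:
  fixes n :: nat and S T :: "complex mat set"
  assumes "n \<ge> 1"
    and "nc_graph 2 S"
    and "nc_graph n T"
    and "capacity_activated 2 S n T"
  shows "S = {c \<cdot>\<^sub>m 1\<^sub>m 2 | c. True}"
proof (rule ccontr)
  assume "S \<noteq> {c \<cdot>\<^sub>m 1\<^sub>m 2 | c. True}"
  then obtain r where r: "r \<in> {1, 2}" "reduces r 2 S 1 (carrier_mat 1 1)"
    using nonscalar_qubit_graph_reduces assms(2) by blast
  have "zero_error_capacity 2 S = log 2 r"
    using r by (intro zero_error_capacity_reduces) auto
  moreover have "zero_error_capacity (2 * n) (nc_tensor 2 S n T) = log 2 r + zero_error_capacity n T \<or>
      zero_error_capacity (2 * n) (nc_tensor 2 S n T) = zero_error_capacity n T"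
    using r assms(1) by (intro zero_error_capacity_tensor_reduces nc_graph_op_space assms(3)) auto
  \<comment> \<open>Nonnegativity settles the second alternative: there the joint capacity equals
    that of \<open>T\<close>, which is at most the sum. The first alternative equals the
    sum.\<close>
  moreover have "log 2 r \<ge> 0" using r(1) by auto
  ultimately show False using assms(4) unfolding capacity_activated_def by auto
qed

end
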